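(* Let $(\mathcal{R},g)$ be an oriented, connected, smooth Riemannian 3-manifold with (possibly empty) boundary and of constant sectional curvature $c\in\mathbb{R}$. Let $\boldsymbol{Y}$ be a smooth vector field on $\mathcal{R}$, not identically zero, which satisfies the Killing equations as well as $\mathrm{curl}(\boldsymbol{Y})=\lambda\boldsymbol{Y}$ for some $\lambda\in\mathbb{R}$. Then $$c=\frac{\lambda^2}{4}.$$ In particular, the only Killing field on a Riemannian manifold (oriented, connected, of dimension 3) of constant negative sectional curvature satisfying $\mathrm{curl}(\boldsymbol{Y})=\lambda\boldsymbol{Y}$ for some constant $\lambda$ is the zero vector field.
   Context: For a smooth vector field $\boldsymbol{X}$ let $\omega^1_{\boldsymbol{X}}=g(\boldsymbol{X},\cdot)$; $\mathrm{curl}(\boldsymbol{X})$ is defined by $\omega^1_{\mathrm{curl}(\boldsymbol{X})}=\star d\omega^1_{\boldsymbol{X}}$, where $\star$ is the Hodge star and $d$ the exterior derivative. $\lambda=0$ is allowed, the metric is not assumed complete, and no boundary condition is imposed on $\boldsymbol{Y}$. *)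

theory Defs
  imports "HOL-Analysis.Analysis"
begin

section \<open>Calculus on relatively open subsets of the half-space\<close>

definition half_space :: "(real^3) set" where
  "half_space = {x. x $ 3 \<ge> 0}"

text \<open>
  Derivatives are taken within the half-space, hence are one-sided at its boundary; as the
  half-space is the closure of its interior they are still unique there. At interior points they are
  the ordinary derivatives.
\<close>

abbreviation hderiv :: "(real^3 \<Rightarrow> 'b::real_normed_vector) \<Rightarrow> real^3 \<Rightarrow> real^3 \<Rightarrow> 'b" where
  "hderiv f x \<equiv> frechet_derivative f (at x within half_space)"

abbreviation pd :: "3 \<Rightarrow> (real^3 \<Rightarrow> 'b::real_normed_vector) \<Rightarrow> real^3 \<Rightarrow> 'b" where
  "pd i f x \<equiv> hderiv f x (axis i 1)"

primrec Ck_open :: "nat \<Rightarrow> 'a set \<Rightarrow> ('a::euclidean_space \<Rightarrow> 'b::real_normed_vector) \<Rightarrow> bool" where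
  "Ck_open 0 U f \<longleftrightarrow> continuous_on U f"
| "Ck_open (Suc k) U f \<longleftrightarrow> f differentiable_on U \<and>
     (\<forall>v. Ck_open k U (\<lambda>x. frechet_derivative f (at x) v))"

text \<open>Smoothness on an arbitrary set: locally there is a smooth extension to an open set.\<close>

definition smooth_on :: "'a set \<Rightarrow> ('a::euclidean_space \<Rightarrow> 'b::real_normed_vector) \<Rightarrow> bool" where
  "smooth_on S f \<longleftrightarrow>
     (\<forall>x\<in>S. \<exists>U F. open U \<and> x \<in> U \<and> (\<forall>k. Ck_open k U F) \<and> (\<forall>y\<in>S \<inter> U. F y = f y))"

section \<open>Oriented smooth 3-manifolds with boundary\<close>

type_synonym 'm chart = "'m set \<times> ('m \<Rightarrow> real^3)"

abbreviation chart_image :: "'m chart \<Rightarrow> (real^3) set" where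
  "chart_image c \<equiv> snd c ` fst c"

definition local_rep :: "'m chart \<Rightarrow> ('m \<Rightarrow> 'b) \<Rightarrow> real^3 \<Rightarrow> 'b" where
  "local_rep c F = F \<circ> inv_into (fst c) (snd c)"

abbreviation transition :: "'m chart \<Rightarrow> 'm chart \<Rightarrow> real^3 \<Rightarrow> real^3" where
  "transition c d \<equiv> local_rep c (snd d)"

definition boundary_chart :: "'m topology \<Rightarrow> 'm chart \<Rightarrow> bool" where
  "boundary_chart M c \<longleftrightarrow>
     openin M (fst c) \<and> openin (top_of_set half_space) (chart_image c) \<and>
     homeomorphic_map (subtopology M (fst c)) (top_of_set (chart_image c)) (snd c)"

text \<open>
  The atlas \<open>A\<close> fixes both the smooth structure and the orientation: its charts are the
  positively oriented ones. The boundary may be empty, since chart images may avoid the boundary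
  of the half-space.
\<close>

definition oriented_smooth_manifold3 :: "'m topology \<Rightarrow> 'm chart set \<Rightarrow> bool" where
  "oriented_smooth_manifold3 M A \<longleftrightarrow>
     Hausdorff_space M \<and> second_countable M \<and>
     (\<forall>c\<in>A. boundary_chart M c) \<and> (\<Union>c\<in>A. fst c) = topspace M \<and>
     (\<forall>c\<in>A. \<forall>d\<in>A. smooth_on (snd c ` (fst c \<inter> fst d)) (transition c d) \<and>
        (\<forall>x\<in>snd c ` (fst c \<inter> fst d). det (matrix (hderiv (transition c d) x)) > 0))"

section \<open>Tangent vectors, vector fields and metrics\<close>

text \<open>
  A tangent vector at a point is the family of its components in the charts around that point,
  related by the derivatives of the transition maps. Components in all other charts are set to
  zero, so that equality of tangent vectors is equality of functions. The linear structure is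
  the componentwise one.
\<close>

type_synonym 'm tangent = "'m chart \<Rightarrow> real^3"

definition charts_at :: "'m chart set \<Rightarrow> 'm \<Rightarrow> 'm chart set" where
  "charts_at A p = {c \<in> A. p \<in> fst c}"

definition tangent_space :: "'m chart set \<Rightarrow> 'm \<Rightarrow> 'm tangent set" where
  "tangent_space A p = {v.
     (\<forall>c\<in>charts_at A p. \<forall>d\<in>charts_at A p. v d = hderiv (transition c d) (snd c p) (v c)) \<and>
     (\<forall>c. c \<notin> charts_at A p \<longrightarrow> v c = 0)}"

definition coord_vector :: "'m chart set \<Rightarrow> 'm chart \<Rightarrow> 'm \<Rightarrow> 3 \<Rightarrow> 'm tangent" where
  "coord_vector A c p i =
     (\<lambda>d. if d \<in> charts_at A p then pd i (transition c d) (snd c p) else 0)"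

type_synonym 'm vfield = "'m \<Rightarrow> 'm tangent"

abbreviation vcomp :: "'m vfield \<Rightarrow> 'm chart \<Rightarrow> real^3 \<Rightarrow> real^3" where
  "vcomp X c \<equiv> local_rep c (\<lambda>p. X p c)"

definition smooth_vector_field :: "'m topology \<Rightarrow> 'm chart set \<Rightarrow> 'm vfield \<Rightarrow> bool" where
  "smooth_vector_field M A X \<longleftrightarrow>
     (\<forall>p\<in>topspace M. X p \<in> tangent_space A p) \<and>
     (\<forall>c\<in>A. smooth_on (chart_image c) (vcomp X c))"

definition zero_field_on :: "'m topology \<Rightarrow> 'm vfield \<Rightarrow> bool" where
  "zero_field_on M X \<longleftrightarrow> (\<forall>p\<in>topspace M. X p = (\<lambda>c. 0))"

definition scale_field :: "real \<Rightarrow> 'm vfield \<Rightarrow> 'm vfield" where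
  "scale_field r X = (\<lambda>p c. r *\<^sub>R X p c)"

type_synonym 'm metric = "'m \<Rightarrow> 'm tangent \<Rightarrow> 'm tangent \<Rightarrow> real"

definition gram :: "'m chart set \<Rightarrow> 'm metric \<Rightarrow> 'm chart \<Rightarrow> real^3 \<Rightarrow> real^3^3" where
  "gram A g c = local_rep c (\<lambda>p. \<chi> i j. g p (coord_vector A c p i) (coord_vector A c p j))"

text \<open>No completeness is required. Bilinearity is linearity on the left plus symmetry.\<close>

definition riemannian_metric :: "'m topology \<Rightarrow> 'm chart set \<Rightarrow> 'm metric \<Rightarrow> bool" where
  "riemannian_metric M A g \<longleftrightarrow>
     (\<forall>p\<in>topspace M. \<forall>u\<in>tangent_space A p. \<forall>v\<in>tangent_space A p.
        (\<forall>w\<in>tangent_space A p. \<forall>a b.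
           g p (\<lambda>c. a *\<^sub>R u c + b *\<^sub>R v c) w = a * g p u w + b * g p v w) \<and>
        g p u v = g p v u \<and>
        (u \<noteq> (\<lambda>c. 0) \<longrightarrow> g p u u > 0)) \<and>
     (\<forall>c\<in>A. smooth_on (chart_image c) (gram A g c))"

section \<open>Riemannian geometry in coordinates\<close>

text \<open>
  In this section \<open>G\<close> is the coordinate matrix of the metric; vector fields and 1-forms are given
  by their components, 2-forms by their skew-symmetric component matrices.
\<close>

definition christoffel :: "(real^3 \<Rightarrow> real^3^3) \<Rightarrow> 3 \<Rightarrow> 3 \<Rightarrow> 3 \<Rightarrow> real^3 \<Rightarrow> real" where
  "christoffel G l i j x = (\<Sum>m\<in>UNIV. matrix_inv (G x) $ l $ m *
     (pd i (\<lambda>y. G y $ j $ m) x + pd j (\<lambda>y. G y $ i $ m) x - pd m (\<lambda>y. G y $ i $ j) x)) / 2"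

text \<open>
  \<open>R(\<partial>\<^sub>i, \<partial>\<^sub>j) \<partial>\<^sub>k = \<Sum>\<^sub>l (riemann G l k i j) \<partial>\<^sub>l\<close>, where
  \<open>R(X, Y) Z = \<nabla>\<^sub>X \<nabla>\<^sub>Y Z - \<nabla>\<^sub>Y \<nabla>\<^sub>X Z - \<nabla>\<^bsub>[X, Y]\<^esub> Z\<close>.
\<close>

definition riemann :: "(real^3 \<Rightarrow> real^3^3) \<Rightarrow> 3 \<Rightarrow> 3 \<Rightarrow> 3 \<Rightarrow> 3 \<Rightarrow> real^3 \<Rightarrow> real" where
  "riemann G l k i j x =
     pd i (christoffel G l j k) x - pd j (christoffel G l i k) x +
     (\<Sum>m\<in>UNIV. christoffel G l i m x * christoffel G m j k x
               - christoffel G l j m x * christoffel G m i k x)"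

definition inner_at :: "(real^3 \<Rightarrow> real^3^3) \<Rightarrow> real^3 \<Rightarrow> real^3 \<Rightarrow> real^3 \<Rightarrow> real" where
  "inner_at G x u v = (\<Sum>i\<in>UNIV. \<Sum>j\<in>UNIV. G x $ i $ j * u $ i * v $ j)"

definition curvature_op :: "(real^3 \<Rightarrow> real^3^3) \<Rightarrow> real^3 \<Rightarrow> real^3 \<Rightarrow> real^3 \<Rightarrow> real^3 \<Rightarrow> real^3" where
  "curvature_op G x u v w =
     (\<chi> l. \<Sum>i\<in>UNIV. \<Sum>j\<in>UNIV. \<Sum>k\<in>UNIV. riemann G l k i j x * u $ i * v $ j * w $ k)"

definition sectional_curvature :: "(real^3 \<Rightarrow> real^3^3) \<Rightarrow> real^3 \<Rightarrow> real^3 \<Rightarrow> real^3 \<Rightarrow> real" where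
  "sectional_curvature G x u v =
     inner_at G x (curvature_op G x u v v) u /
     (inner_at G x u u * inner_at G x v v - (inner_at G x u v)\<^sup>2)"

text \<open>The 1-form \<open>g(X, \<cdot>)\<close>.\<close>

definition flat :: "(real^3 \<Rightarrow> real^3^3) \<Rightarrow> (real^3 \<Rightarrow> real^3) \<Rightarrow> real^3 \<Rightarrow> real^3" where
  "flat G X x = (\<chi> j. \<Sum>i\<in>UNIV. G x $ i $ j * X x $ i)"

definition covariant_deriv1 ::
  "(real^3 \<Rightarrow> real^3^3) \<Rightarrow> (real^3 \<Rightarrow> real^3) \<Rightarrow> 3 \<Rightarrow> 3 \<Rightarrow> real^3 \<Rightarrow> real" where
  "covariant_deriv1 G w i j x =
     pd i (\<lambda>y. w y $ j) x - (\<Sum>l\<in>UNIV. christoffel G l i j x * w x $ l)"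

definition ext_deriv1 :: "(real^3 \<Rightarrow> real^3) \<Rightarrow> real^3 \<Rightarrow> real^3^3" where
  "ext_deriv1 w x = (\<chi> i j. pd i (\<lambda>y. w y $ j) x - pd j (\<lambda>y. w y $ i) x)"

definition levi_civita :: "3 \<Rightarrow> 3 \<Rightarrow> 3 \<Rightarrow> real" where
  "levi_civita i j k = det (vector [axis i 1, axis j 1, axis k 1] :: real^3^3)"

text \<open>
  The Hodge star of a 2-form in a positively oriented chart: contraction of the 2-form, with
  indices raised, with the Riemannian volume form.
\<close>

definition hodge2 :: "(real^3 \<Rightarrow> real^3^3) \<Rightarrow> (real^3 \<Rightarrow> real^3^3) \<Rightarrow> real^3 \<Rightarrow> real^3" where
  "hodge2 G b x = (\<chi> k. sqrt (det (G x)) / 2 *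
     (\<Sum>i\<in>UNIV. \<Sum>j\<in>UNIV. \<Sum>p\<in>UNIV. \<Sum>q\<in>UNIV.
        matrix_inv (G x) $ i $ p * matrix_inv (G x) $ j $ q * b x $ p $ q * levi_civita i j k))"

section \<open>Curvature, Killing fields and curl on the manifold\<close>

text \<open>
  The notions below are independent of coordinates; they are expressed in every chart. Nothing is
  required at boundary points beyond the stated equations.
\<close>

definition constant_sectional_curvature ::
  "'m chart set \<Rightarrow> 'm metric \<Rightarrow> real \<Rightarrow> bool" where
  "constant_sectional_curvature A g k \<longleftrightarrow>
     (\<forall>c\<in>A. \<forall>x\<in>chart_image c. \<forall>u v. u \<noteq> v \<and> independent {u, v} \<longrightarrow>
        sectional_curvature (gram A g c) x u v = k)"

definition killing_field :: "'m chart set \<Rightarrow> 'm metric \<Rightarrow> 'm vfield \<Rightarrow> bool" where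
  "killing_field A g X \<longleftrightarrow>
     (\<forall>c\<in>A. \<forall>x\<in>chart_image c. \<forall>i j.
        covariant_deriv1 (gram A g c) (flat (gram A g c) (vcomp X c)) i j x +
        covariant_deriv1 (gram A g c) (flat (gram A g c) (vcomp X c)) j i x = 0)"

text \<open>
  \<open>has_curl A g X Z\<close> says that the vector field \<open>Z\<close> is the curl of \<open>X\<close>. Since the metric is
  nondegenerate, this determines \<open>Z\<close>.
\<close>

definition has_curl :: "'m chart set \<Rightarrow> 'm metric \<Rightarrow> 'm vfield \<Rightarrow> 'm vfield \<Rightarrow> bool" where
  "has_curl A g X Z \<longleftrightarrow>
     (\<forall>c\<in>A. \<forall>x\<in>chart_image c.
        flat (gram A g c) (vcomp Z c) x =
        hodge2 (gram A g c) (ext_deriv1 (flat (gram A g c) (vcomp X c))) x)"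

end

theory Submission
  imports Defs
begin

text \<open>
  The statement is local and needs only one point where \<open>Y\<close> does not vanish. Such a point can be
  chosen in the interior of a chart image, since the zero set is closed and the half-space is the
  closure of its interior. There all derivatives are ordinary ones.

  Let \<open>B = \<nabla>Y\<close>, the endomorphism \<open>v \<mapsto> \<nabla>\<^sub>v Y\<close>. The Killing equation says that \<open>B\<close> is skew for the
  metric, so \<open>B\<close> is half of \<open>d\<omega>\<^sup>1\<close>, and in dimension three the curl equation then says that \<open>B\<close> is,
  up to sign, \<open>\<lambda>/2\<close> times the cross product with \<open>Y\<close>. Three consequences are all that is used
  (\<open>curl_eigen_covariant_derivative\<close>):
  \<open>B Y = 0\<close>, \<open>tr B = 0\<close> and \<open>tr (B\<^sup>2) = - \<lambda>\<^sup>2/2 |Y|\<^sup>2\<close>.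
  The first two hold in a neighbourhood and may be differentiated. The divergence of the
  geodesic equation \<open>\<nabla>\<^sub>Y Y = 0\<close>, minus the derivative of \<open>div Y = 0\<close> along \<open>Y\<close>, is the contracted Ricci
  identity \<open>tr (B\<^sup>2) + Ric(Y, Y) = 0\<close> (\<open>contracted_ricci_identity\<close>). Constant sectional curvature \<open>c\<close>
  gives \<open>Ric(Y, Y) = 2 c |Y|\<^sup>2\<close> (\<open>ricci_of_constant_curvature\<close>), hence \<open>(2 c - \<lambda>\<^sup>2/2) |Y|\<^sup>2 = 0\<close>.
\<close>

section \<open>Symmetry of second derivatives and local smoothness\<close>

text \<open>
  The second difference along \<open>u\<close> and \<open>v\<close> is a mixed derivative at an intermediate point: apply the
  mean value theorem first along \<open>u\<close>, then along \<open>v\<close>.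
\<close>

lemma second_difference_mean_value:
  fixes f :: "'a::real_normed_vector \<Rightarrow> real"
  assumes t: "0 < t"
    and f: "\<And>a b. \<lbrakk>0 \<le> a; a \<le> t; 0 \<le> b; b \<le> t\<rbrakk> \<Longrightarrow>
              (f has_derivative f' (x + a *\<^sub>R u + b *\<^sub>R v)) (at (x + a *\<^sub>R u + b *\<^sub>R v))"
    and f': "\<And>a b. \<lbrakk>0 \<le> a; a \<le> t; 0 \<le> b; b \<le> t\<rbrakk> \<Longrightarrow>
              ((\<lambda>y. f' y u) has_derivative f'' (x + a *\<^sub>R u + b *\<^sub>R v)) (at (x + a *\<^sub>R u + b *\<^sub>R v))"
  obtains a b where "0 < a" "a < t" "0 < b" "b < t"
    "f (x + t *\<^sub>R u + t *\<^sub>R v) - f (x + t *\<^sub>R u) - f (x + t *\<^sub>R v) + f x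
       = t * t * f'' (x + a *\<^sub>R u + b *\<^sub>R v) v"
proof -
  have d: "((\<lambda>s. f (x + s *\<^sub>R u + b *\<^sub>R v)) has_real_derivative f' (x + s *\<^sub>R u + b *\<^sub>R v) u) (at s)"
    if "0 \<le> s" "s \<le> t" "0 \<le> b" "b \<le> t" for s b
  proof -
    have "((\<lambda>s. f (x + s *\<^sub>R u + b *\<^sub>R v)) has_derivative
            (\<lambda>h. f' (x + s *\<^sub>R u + b *\<^sub>R v) (h *\<^sub>R u))) (at s)"
      by (rule has_derivative_compose[where f="\<lambda>s. x + s *\<^sub>R u + b *\<^sub>R v" and g=f, OF _ f[OF that]])
         (auto intro!: derivative_eq_intros)
    moreover have "f' (x + s *\<^sub>R u + b *\<^sub>R v) (h *\<^sub>R u) = f' (x + s *\<^sub>R u + b *\<^sub>R v) u * h" for h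
      using has_derivative_linear[OF f[OF that]] by (simp add: linear_cmul)
    ultimately show ?thesis by (simp add: has_field_derivative_def mult_commute_abs)
  qed
  have d': "((\<lambda>r. f' (x + s *\<^sub>R u + r *\<^sub>R v) u) has_real_derivative f'' (x + s *\<^sub>R u + r *\<^sub>R v) v) (at r)"
    if "0 \<le> s" "s \<le> t" "0 \<le> r" "r \<le> t" for s r
  proof -
    have "((\<lambda>r. f' (x + s *\<^sub>R u + r *\<^sub>R v) u) has_derivative
            (\<lambda>h. f'' (x + s *\<^sub>R u + r *\<^sub>R v) (h *\<^sub>R v))) (at r)"
      by (rule has_derivative_compose[where f="\<lambda>r. x + s *\<^sub>R u + r *\<^sub>R v" and g="\<lambda>y. f' y u",
            OF _ f'[OF that]])
         (auto intro!: derivative_eq_intros)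
    moreover have "f'' (x + s *\<^sub>R u + r *\<^sub>R v) (h *\<^sub>R v) = f'' (x + s *\<^sub>R u + r *\<^sub>R v) v * h" for h
      using has_derivative_linear[OF f'[OF that]] by (simp add: linear_cmul)
    ultimately show ?thesis by (simp add: has_field_derivative_def mult_commute_abs)
  qed
  let ?p = "\<lambda>s. f (x + s *\<^sub>R u + t *\<^sub>R v) - f (x + s *\<^sub>R u + 0 *\<^sub>R v)"
  have "\<exists>a. 0 < a \<and> a < t \<and> ?p t - ?p 0
          = (t - 0) * (f' (x + a *\<^sub>R u + t *\<^sub>R v) u - f' (x + a *\<^sub>R u + 0 *\<^sub>R v) u)"
    using t by (intro MVT2 DERIV_diff d) auto
  then obtain a where a: "0 < a" "a < t"
    and ea: "?p t - ?p 0 = t * (f' (x + a *\<^sub>R u + t *\<^sub>R v) u - f' (x + a *\<^sub>R u + 0 *\<^sub>R v) u)"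
    by auto
  have "\<exists>b. 0 < b \<and> b < t \<and> f' (x + a *\<^sub>R u + t *\<^sub>R v) u - f' (x + a *\<^sub>R u + 0 *\<^sub>R v) u
          = (t - 0) * f'' (x + a *\<^sub>R u + b *\<^sub>R v) v"
    using t a by (intro MVT2 d') auto
  then obtain b where b: "0 < b" "b < t"
    and eb: "f' (x + a *\<^sub>R u + t *\<^sub>R v) u - f' (x + a *\<^sub>R u + 0 *\<^sub>R v) u
          = t * f'' (x + a *\<^sub>R u + b *\<^sub>R v) v"
    by auto
  show ?thesis
    using ea unfolding eb by (intro that[OF a b]) simp
qed

text \<open>
  The second difference does not depend on the order of the two directions, so both mixed
  derivatives take the same value at points arbitrarily close to \<open>x\<close>; continuity does the rest.
\<close>

lemma second_derivative_symmetric: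
  fixes f :: "'a::real_normed_vector \<Rightarrow> real"
  assumes N: "open N" "x \<in> N"
    and f: "\<And>y. y \<in> N \<Longrightarrow> (f has_derivative f' y) (at y)"
    and fu: "\<And>y. y \<in> N \<Longrightarrow> ((\<lambda>y. f' y u) has_derivative fu y) (at y)"
    and fv: "\<And>y. y \<in> N \<Longrightarrow> ((\<lambda>y. f' y v) has_derivative fv y) (at y)"
    and cu: "continuous_on N (\<lambda>y. fu y v)"
    and cv: "continuous_on N (\<lambda>y. fv y u)"
  shows "fu x v = fv x u"
proof (rule ccontr)
  assume ne: "fu x v \<noteq> fv x u"
  define e where "e = \<bar>fu x v - fv x u\<bar> / 2"
  have e: "e > 0" using ne by (simp add: e_def)
  obtain r where r: "r > 0" "ball x r \<subseteq> N"
    using N by (meson open_contains_ball)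
  obtain p where p: "p > 0" "\<And>y. y \<in> N \<Longrightarrow> dist y x < p \<Longrightarrow> dist (fu y v) (fu x v) < e"
    using cu N e unfolding continuous_on_iff by meson
  obtain q where q: "q > 0" "\<And>y. y \<in> N \<Longrightarrow> dist y x < q \<Longrightarrow> dist (fv y u) (fv x u) < e"
    using cv N e unfolding continuous_on_iff by meson
  (* All base points used below have coefficients in [0, t], hence lie within distance m of x. *)
  define m where "m = min r (min p q)"
  have m: "m > 0" using r p q by (simp add: m_def)
  define t where "t = m / (norm u + norm v + 1)"
  have t: "t > 0" using m by (simp add: t_def add_nonneg_pos)
  have near: "dist (x + a *\<^sub>R u + b *\<^sub>R v) x < m" if "0 \<le> a" "a \<le> t" "0 \<le> b" "b \<le> t" for a b
  proof -
    have "dist (x + a *\<^sub>R u + b *\<^sub>R v) x = norm (a *\<^sub>R u + b *\<^sub>R v)" by (simp add: dist_norm)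
    also have "\<dots> \<le> norm (a *\<^sub>R u) + norm (b *\<^sub>R v)" by (rule norm_triangle_ineq)
    also have "\<dots> \<le> t * norm u + t * norm v" using that by (auto intro!: add_mono mult_right_mono)
    also have "\<dots> < t * (norm u + norm v + 1)" using t by (simp add: algebra_simps)
    also have "\<dots> = m" unfolding t_def using norm_ge_zero[of u] norm_ge_zero[of v]
      by (simp add: add_nonneg_eq_0_iff)
    finally show ?thesis .
  qed
  have inN: "x + a *\<^sub>R u + b *\<^sub>R v \<in> N" if "0 \<le> a" "a \<le> t" "0 \<le> b" "b \<le> t" for a b
    using near[OF that] r unfolding m_def by (auto simp: dist_commute subset_eq)
  have inN': "x + b *\<^sub>R v + a *\<^sub>R u \<in> N" if "0 \<le> b" "b \<le> t" "0 \<le> a" "a \<le> t" for a b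
    using inN[OF that(3,4,1,2)] by (simp add: algebra_simps)
  obtain a b where ab: "0 < a" "a < t" "0 < b" "b < t"
    and e1: "f (x + t *\<^sub>R u + t *\<^sub>R v) - f (x + t *\<^sub>R u) - f (x + t *\<^sub>R v) + f x
       = t * t * fu (x + a *\<^sub>R u + b *\<^sub>R v) v"
    by (rule second_difference_mean_value[OF t, of f f' x u v fu]) (auto intro: f fu inN)
  obtain c d where cd: "0 < c" "c < t" "0 < d" "d < t"
    and e2: "f (x + t *\<^sub>R v + t *\<^sub>R u) - f (x + t *\<^sub>R v) - f (x + t *\<^sub>R u) + f x
       = t * t * fv (x + c *\<^sub>R v + d *\<^sub>R u) u"
    by (rule second_difference_mean_value[OF t, of f f' x v u fv]) (auto intro: f fv inN')
  have "t * t * fu (x + a *\<^sub>R u + b *\<^sub>R v) v = t * t * fv (x + c *\<^sub>R v + d *\<^sub>R u) u"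
    using e1 e2 by (simp add: algebra_simps)
  hence eq: "fu (x + a *\<^sub>R u + b *\<^sub>R v) v = fv (x + d *\<^sub>R u + c *\<^sub>R v) u"
    using t by (simp add: algebra_simps)
  have 1: "dist (fu (x + a *\<^sub>R u + b *\<^sub>R v) v) (fu x v) < e"
    using ab near[of a b] by (intro p inN) (auto simp: m_def)
  have 2: "dist (fv (x + d *\<^sub>R u + c *\<^sub>R v) u) (fv x u) < e"
    using cd near[of d c] by (intro q inN) (auto simp: m_def)
  have "\<bar>fu x v - fv x u\<bar> < e + e"
    using 1 2 unfolding eq dist_real_def by linarith
  thus False by (simp add: e_def)
qed

text \<open>
  \<open>smooth_on\<close> provides only local extensions. On an open set these extensions determine the
  derivatives, so they glue, and iterated differentiability holds on the whole set.
\<close>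

lemma Ck_open_local:
  fixes f :: "'a::euclidean_space \<Rightarrow> 'b::real_normed_vector"
  assumes "open N"
    and "\<And>x. x \<in> N \<Longrightarrow> \<exists>U F. open U \<and> x \<in> U \<and> Ck_open k U F \<and> (\<forall>y\<in>N \<inter> U. F y = f y)"
  shows "Ck_open k N f"
  using assms(2)
proof (induction k arbitrary: f)
  case 0
  have "isCont f x" if x: "x \<in> N" for x
  proof -
    obtain U F where U: "open U" "x \<in> U" "continuous_on U F" "\<And>y. y \<in> N \<inter> U \<Longrightarrow> F y = f y"
      using 0[OF x] by auto
    have "isCont F x" using U continuous_on_eq_continuous_at by blast
    moreover have "\<forall>\<^sub>F y in nhds x. F y = f y"
      using U x \<open>open N\<close> by (intro eventually_nhds[THEN iffD2] exI[of _ "N \<inter> U"]) auto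
    ultimately show ?thesis by (simp cong: isCont_cong)
  qed
  thus ?case using \<open>open N\<close> by (simp add: continuous_on_eq_continuous_at)
next
  case (Suc k)
  have diff: "f differentiable (at x) \<and> (\<exists>U F. open U \<and> x \<in> U \<and> Ck_open (Suc k) U F \<and>
      (\<forall>y\<in>N \<inter> U. frechet_derivative F (at y) = frechet_derivative f (at y)))"
    if x: "x \<in> N" for x
  proof -
    obtain U F where U: "open U" "x \<in> U" "Ck_open (Suc k) U F" "\<And>y. y \<in> N \<inter> U \<Longrightarrow> F y = f y"
      using Suc.prems[OF x] by blast
    have D: "F differentiable (at y)" if "y \<in> U" for y
      using U that by (simp add: differentiable_on_def at_within_open_NO_MATCH)
    have "frechet_derivative F (at y) = frechet_derivative f (at y)" if "y \<in> N \<inter> U" for y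
      using that U D \<open>open N\<close> by (intro frechet_derivative_transform_within_open[of _ _ "N \<inter> U"]) auto
    moreover have "f differentiable (at x)"
    proof -
      have "(F has_derivative frechet_derivative F (at x)) (at x)"
        using D U by (simp add: frechet_derivative_works[symmetric])
      hence "(f has_derivative frechet_derivative F (at x)) (at x)"
        by (rule has_derivative_transform_within_open[of _ _ _ _ "N \<inter> U"])
           (use U \<open>open N\<close> x in auto)
      thus ?thesis by (rule differentiableI)
    qed
    ultimately show ?thesis using U by blast
  qed
  have "Ck_open k N (\<lambda>y. frechet_derivative f (at y) v)" for v
  proof (rule Suc.IH)
    fix x assume "x \<in> N"
    then obtain U F where U: "open U" "x \<in> U" "Ck_open (Suc k) U F"
      "\<forall>y\<in>N \<inter> U. frechet_derivative F (at y) = frechet_derivative f (at y)"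
      using diff by blast
    thus "\<exists>U F. open U \<and> x \<in> U \<and> Ck_open k U F \<and>
        (\<forall>y\<in>N \<inter> U. F y = frechet_derivative f (at y) v)"
      by (intro exI[of _ U] exI[of _ "\<lambda>y. frechet_derivative F (at y) v"]) auto
  qed
  thus ?case using diff \<open>open N\<close> by (auto simp: differentiable_on_def at_within_open_NO_MATCH)
qed

lemma Ck_open_cong:
  assumes "open N" "Ck_open k N f" "\<And>y. y \<in> N \<Longrightarrow> f y = h y"
  shows "Ck_open k N h"
  using assms by (intro Ck_open_local) auto

lemma smooth_on_imp_Ck_open:
  assumes "smooth_on S f" "open N" "N \<subseteq> S"
  shows "Ck_open k N f"
proof (rule Ck_open_local[OF \<open>open N\<close>])
  fix x assume "x \<in> N"
  then obtain U F where "open U \<and> x \<in> U \<and> (\<forall>k. Ck_open k U F) \<and> (\<forall>y\<in>S \<inter> U. F y = f y)"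
    using assms unfolding smooth_on_def by (meson subsetD)
  thus "\<exists>U F. open U \<and> x \<in> U \<and> Ck_open k U F \<and> (\<forall>y\<in>N \<inter> U. F y = f y)"
    using assms(3) by blast
qed

lemma Ck_open_bounded_linear:
  assumes "bounded_linear h" "open N" "Ck_open k N f"
  shows "Ck_open k N (\<lambda>x. h (f x))"
  using assms(3)
proof (induction k arbitrary: f)
  case 0
  thus ?case using assms(1) by (auto intro: bounded_linear.continuous_on)
next
  case (Suc k)
  have d: "((\<lambda>x. h (f x)) has_derivative (\<lambda>v. h (frechet_derivative f (at x) v))) (at x)"
    if "x \<in> N" for x
    using Suc.prems that \<open>open N\<close>
    by (intro bounded_linear.has_derivative[OF assms(1)])
       (simp add: differentiable_on_def at_within_open_NO_MATCH frechet_derivative_works[symmetric])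
  have "(\<lambda>x. h (f x)) differentiable_on N"
    using d unfolding differentiable_on_def
    by (blast intro: differentiableI has_derivative_at_withinI)
  moreover have "Ck_open k N (\<lambda>x. frechet_derivative (\<lambda>x. h (f x)) (at x) v)" for v
  proof (rule Ck_open_cong[OF \<open>open N\<close>])
    show "Ck_open k N (\<lambda>x. h (frechet_derivative f (at x) v))"
      using Suc by simp
  qed (simp add: frechet_derivative_at[OF d, symmetric])
  ultimately show ?case by simp
qed

lemma hderiv_open:
  assumes "open N" "N \<subseteq> half_space" "x \<in> N"
  shows "hderiv f x = frechet_derivative f (at x)"
  using at_within_open_subset[OF assms(3,1,2)] by simp

lemma Ck_open_has_hderiv:
  assumes "open N" "N \<subseteq> half_space" "x \<in> N" "Ck_open (Suc k) N f"
  shows "(f has_derivative hderiv f x) (at x)"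
proof -
  have "f differentiable (at x)"
    using assms(1,3,4) by (simp add: differentiable_on_def at_within_open_NO_MATCH)
  thus ?thesis
    unfolding hderiv_open[OF assms(1-3)] by (simp add: frechet_derivative_works[symmetric])
qed

lemma Ck_open_pd:
  assumes "open N" "N \<subseteq> half_space" "Ck_open (Suc k) N f"
  shows "Ck_open k N (pd i f)"
proof (rule Ck_open_cong[OF assms(1)])
  show "Ck_open k N (\<lambda>y. frechet_derivative f (at y) (axis i 1))"
    using assms(3) by simp
qed (simp only: hderiv_open[OF assms(1,2)])

lemma pd_commute:
  fixes f :: "real^3 \<Rightarrow> real"
  assumes N: "open N" "N \<subseteq> half_space" "x \<in> N" and f: "Ck_open (Suc (Suc 0)) N f"
  shows "pd i (pd j f) x = pd j (pd i f) x"
proof (rule second_derivative_symmetric[OF N(1,3), of f "hderiv f" "axis j 1" "hderiv (pd j f)" "axis i 1" "hderiv (pd i f)"])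
  show "(f has_derivative hderiv f y) (at y)" if "y \<in> N" for y
    using Ck_open_has_hderiv[OF N(1,2) that f] .
  have "(pd k f has_derivative hderiv (pd k f) y) (at y)" if "y \<in> N" for y k
    using Ck_open_has_hderiv[OF N(1,2) that Ck_open_pd[OF N(1,2) f]] .
  thus "y \<in> N \<Longrightarrow> (pd j f has_derivative hderiv (pd j f) y) (at y)"
    and "y \<in> N \<Longrightarrow> (pd i f has_derivative hderiv (pd i f) y) (at y)" for y
    by blast+
  have "continuous_on N (pd l (pd k f))" for k l
    using Ck_open_pd[OF N(1,2) Ck_open_pd[OF N(1,2) f]] by simp
  thus "continuous_on N (pd i (pd j f))" "continuous_on N (pd j (pd i f))" by this+
qed


section \<open>The contracted Ricci identity\<close>

text \<open>
  The purely algebraic part of the contracted Ricci identity at a point. Here \<open>y\<close>, \<open>a k i\<close> and \<open>h k i j\<close>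
  stand for \<open>Y\<^sup>k\<close>, \<open>\<partial>\<^sub>i Y\<^sup>k\<close> and \<open>\<partial>\<^sub>j \<partial>\<^sub>i Y\<^sup>k\<close>, and \<open>gm l i j\<close>, \<open>dg l i j p\<close> for a Christoffel symbol and its
  derivative in direction \<open>p\<close>. The identity is the sum of \<open>e1\<close> over \<open>k\<close>, minus the sum of \<open>y j\<close> times \<open>e2\<close> over
  \<open>j\<close>, plus the sum over \<open>l\<close> of \<open>e0\<close> weighted by the contracted symbol \<open>\<Sum>\<^sub>k \<Gamma>\<^sup>k\<^sub>k\<^sub>l\<close>; the second derivatives
  cancel.
\<close>

lemma contracted_ricci_algebra:
  fixes y :: "3 \<Rightarrow> real" and a :: "3 \<Rightarrow> 3 \<Rightarrow> real" and h gm :: "3 \<Rightarrow> 3 \<Rightarrow> 3 \<Rightarrow> real"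
    and dg :: "3 \<Rightarrow> 3 \<Rightarrow> 3 \<Rightarrow> 3 \<Rightarrow> real"
  assumes h: "\<And>k i j. h k i j = h k j i" and gm: "\<And>l i j. gm l i j = gm l j i"
    and e0: "\<And>k. (\<Sum>i\<in>UNIV. y i * (a k i + (\<Sum>l\<in>UNIV. gm k i l * y l))) = 0"
    and e1: "\<And>k. (\<Sum>i\<in>UNIV. y i * (h k i k + (\<Sum>l\<in>UNIV. gm k i l * a l k + dg k i l k * y l))
                + a i k * (a k i + (\<Sum>l\<in>UNIV. gm k i l * y l))) = 0"
    and e2: "\<And>j. (\<Sum>k\<in>UNIV. h k k j + (\<Sum>l\<in>UNIV. gm k k l * a l j + dg k k l j * y l)) = 0"
  shows "(\<Sum>i\<in>UNIV. \<Sum>k\<in>UNIV. (a k i + (\<Sum>l\<in>UNIV. gm k i l * y l)) * (a i k + (\<Sum>l\<in>UNIV. gm i k l * y l)))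
     + (\<Sum>i\<in>UNIV. \<Sum>l\<in>UNIV. (\<Sum>s\<in>UNIV. dg s i l s - dg s s l i +
           (\<Sum>m\<in>UNIV. gm s s m * gm m i l - gm s i m * gm m s l)) * y i * y l) = 0"
proof -
  define P where "P k i = (\<Sum>l\<in>UNIV. gm k i l * y l)" for k i
  define q where "q l = (\<Sum>k\<in>UNIV. gm k k l)" for l
  define D1 where "D1 = (\<Sum>k\<in>UNIV. \<Sum>i\<in>UNIV. \<Sum>l\<in>UNIV. dg k i l k * y i * y l)"
  define D2 where "D2 = (\<Sum>j\<in>UNIV. \<Sum>k\<in>UNIV. \<Sum>l\<in>UNIV. dg k k l j * y l * y j)"
  define H where "H = (\<Sum>k\<in>UNIV. \<Sum>i\<in>UNIV. y i * h k i k)"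
  have E0: "(\<Sum>i\<in>UNIV. y i * a k i) = - (\<Sum>i\<in>UNIV. y i * P k i)" for k
    using e0[of k] unfolding P_def[symmetric] by (simp add: sum.distrib distrib_left eq_neg_iff_add_eq_0)
  have gP: "(\<Sum>i\<in>UNIV. \<Sum>l\<in>UNIV. y i * (gm k i l * a l k)) = (\<Sum>i\<in>UNIV. a i k * P k i)" for k
  proof -
    have "(\<Sum>i\<in>UNIV. \<Sum>l\<in>UNIV. y i * (gm k i l * a l k)) = (\<Sum>l\<in>UNIV. \<Sum>i\<in>UNIV. y i * (gm k l i * a l k))"
      by (subst sum.swap) (simp add: gm)
    thus ?thesis by (simp add: P_def sum_distrib_left algebra_simps)
  qed
  have "(\<Sum>i\<in>UNIV. y i * h k i k) + (\<Sum>i\<in>UNIV. a i k * P k i)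
      + (\<Sum>i\<in>UNIV. \<Sum>l\<in>UNIV. dg k i l k * y i * y l)
      + (\<Sum>i\<in>UNIV. a i k * (a k i + P k i)) = 0" for k
    using e1[of k] unfolding gP[symmetric] P_def[symmetric]
    by (simp add: sum.distrib sum_distrib_left distrib_left) (simp add: algebra_simps)
  hence "(\<Sum>k\<in>UNIV. (\<Sum>i\<in>UNIV. y i * h k i k) + (\<Sum>i\<in>UNIV. a i k * P k i)
      + (\<Sum>i\<in>UNIV. \<Sum>l\<in>UNIV. dg k i l k * y i * y l)
      + (\<Sum>i\<in>UNIV. a i k * (a k i + P k i))) = 0"
    by simp
  hence E1: "H + D1 + (\<Sum>k\<in>UNIV. \<Sum>i\<in>UNIV. a i k * a k i + 2 * (a i k * P k i)) = 0"
    by (simp add: H_def D1_def sum.distrib distrib_left sum_distrib_left[symmetric] algebra_simps)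
  have "(\<Sum>j\<in>UNIV. y j * (\<Sum>k\<in>UNIV. h k k j + (\<Sum>l\<in>UNIV. gm k k l * a l j + dg k k l j * y l))) = 0"
    using e2 by simp
  moreover have "(\<Sum>j\<in>UNIV. y j * (\<Sum>k\<in>UNIV. h k k j)) = H"
    unfolding H_def sum_distrib_left by (subst sum.swap) (simp add: h)
  moreover have "(\<Sum>j\<in>UNIV. y j * (\<Sum>k\<in>UNIV. \<Sum>l\<in>UNIV. gm k k l * a l j)) = (\<Sum>l\<in>UNIV. q l * (\<Sum>j\<in>UNIV. y j * a l j))"
    by (simp add: q_def sum_3 algebra_simps)
  moreover have "(\<Sum>j\<in>UNIV. y j * (\<Sum>k\<in>UNIV. \<Sum>l\<in>UNIV. dg k k l j * y l)) = D2"
    by (simp add: D2_def sum_distrib_left algebra_simps)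
  ultimately have E2: "H + D2 - (\<Sum>l\<in>UNIV. q l * (\<Sum>i\<in>UNIV. y i * P l i)) = 0"
    unfolding E0 by (simp add: sum.distrib distrib_left sum_negf)
  have T: "(\<Sum>i\<in>UNIV. \<Sum>k\<in>UNIV. (a k i + P k i) * (a i k + P i k))
     = (\<Sum>k\<in>UNIV. \<Sum>i\<in>UNIV. a i k * a k i + 2 * (a i k * P k i)) + (\<Sum>k\<in>UNIV. \<Sum>i\<in>UNIV. P i k * P k i)"
    by (simp add: sum_3 algebra_simps)
  have r1: "(\<Sum>i\<in>UNIV. \<Sum>l\<in>UNIV. (\<Sum>s\<in>UNIV. dg s i l s) * y i * y l) = D1"
    by (simp add: D1_def sum_3 algebra_simps)
  have r2: "(\<Sum>i\<in>UNIV. \<Sum>l\<in>UNIV. (\<Sum>s\<in>UNIV. dg s s l i) * y i * y l) = D2"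
    by (simp add: D2_def sum_3 algebra_simps)
  have r3: "(\<Sum>i\<in>UNIV. \<Sum>l\<in>UNIV. (\<Sum>s\<in>UNIV. \<Sum>m\<in>UNIV. gm s s m * gm m i l) * y i * y l)
      = (\<Sum>l\<in>UNIV. q l * (\<Sum>i\<in>UNIV. y i * P l i))"
  proof -
    have "(\<Sum>s\<in>UNIV. \<Sum>m\<in>UNIV. gm s s m * gm m i l) = (\<Sum>m\<in>UNIV. q m * gm m i l)" for i l
      by (subst sum.swap) (simp add: q_def sum_distrib_right)
    thus ?thesis by (simp add: P_def sum_3 algebra_simps)
  qed
  have r4: "(\<Sum>i\<in>UNIV. \<Sum>l\<in>UNIV. (\<Sum>s\<in>UNIV. \<Sum>m\<in>UNIV. gm s i m * gm m s l) * y i * y l)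
      = (\<Sum>k\<in>UNIV. \<Sum>i\<in>UNIV. P i k * P k i)"
  proof -
    have "(\<Sum>l\<in>UNIV. (\<Sum>s\<in>UNIV. \<Sum>m\<in>UNIV. gm s i m * gm m s l) * y i * y l)
        = (\<Sum>s\<in>UNIV. \<Sum>m\<in>UNIV. gm s m i * y i * P m s)" for i
      by (simp add: P_def sum_3 gm[of _ i] algebra_simps)
    moreover have "(\<Sum>i\<in>UNIV. \<Sum>s\<in>UNIV. \<Sum>m\<in>UNIV. gm s m i * y i * P m s) = (\<Sum>s\<in>UNIV. \<Sum>m\<in>UNIV. P s m * P m s)"
      unfolding P_def[of s m for s m] by (simp add: sum_3 algebra_simps)
    ultimately show ?thesis by (simp add: mult.commute)
  qed
  have R: "(\<Sum>i\<in>UNIV. \<Sum>l\<in>UNIV. (\<Sum>s\<in>UNIV. dg s i l s - dg s s l i +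
           (\<Sum>m\<in>UNIV. gm s s m * gm m i l - gm s i m * gm m s l)) * y i * y l)
     = D1 - D2 + (\<Sum>l\<in>UNIV. q l * (\<Sum>i\<in>UNIV. y i * P l i)) - (\<Sum>k\<in>UNIV. \<Sum>i\<in>UNIV. P i k * P k i)"
    unfolding r1[symmetric] r2[symmetric] r3[symmetric] r4[symmetric]
    by (simp only: sum_subtractf sum.distrib left_diff_distrib distrib_right)
  show ?thesis
    unfolding P_def[symmetric] T R using E1 E2 by simp
qed

lemma has_derivative_zero_on_open:
  assumes "(f has_derivative f') (at x)" "open N" "x \<in> N" "\<And>y. y \<in> N \<Longrightarrow> f y = 0"
  shows "f' v = 0"
proof -
  have "((\<lambda>_. 0) has_derivative f') (at x)"
    by (rule has_derivative_transform_within_open[OF assms(1-3)]) (simp add: assms(4))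
  hence "f' = (\<lambda>_. 0)"
    by (intro has_derivative_unique[of "\<lambda>_. 0" _ x]) auto
  thus ?thesis by simp
qed

text \<open>
  For a divergence-free field with geodesic integral curves, \<open>tr ((\<nabla>Y)\<^sup>2) + Ric(Y, Y) = 0\<close>. The
  hypotheses of the algebraic identity are the geodesic equation at the point, its divergence, and
  the partial derivatives of \<open>div Y = 0\<close>. The connection may be any torsion-free one.
\<close>

lemma contracted_ricci_identity:
  fixes Y :: "3 \<Rightarrow> real^3 \<Rightarrow> real" and Gm :: "3 \<Rightarrow> 3 \<Rightarrow> 3 \<Rightarrow> real^3 \<Rightarrow> real"
  assumes N: "open N" "N \<subseteq> half_space" "x \<in> N"
    and Y: "\<And>k. Ck_open (Suc (Suc 0)) N (Y k)"
    and Gm: "\<And>l i j. Gm l i j differentiable (at x)"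
    and sym: "\<And>l i j. Gm l i j x = Gm l j i x"
    and geo: "\<And>y k. y \<in> N \<Longrightarrow>
      (\<Sum>i\<in>UNIV. Y i y * (pd i (Y k) y + (\<Sum>l\<in>UNIV. Gm k i l y * Y l y))) = 0"
    and div: "\<And>y. y \<in> N \<Longrightarrow> (\<Sum>k\<in>UNIV. pd k (Y k) y + (\<Sum>l\<in>UNIV. Gm k k l y * Y l y)) = 0"
  shows "(\<Sum>i\<in>UNIV. \<Sum>k\<in>UNIV. (pd i (Y k) x + (\<Sum>l\<in>UNIV. Gm k i l x * Y l x))
                          * (pd k (Y i) x + (\<Sum>l\<in>UNIV. Gm i k l x * Y l x)))
     + (\<Sum>i\<in>UNIV. \<Sum>l\<in>UNIV. (\<Sum>s\<in>UNIV. pd s (Gm s i l) x - pd i (Gm s s l) x +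
           (\<Sum>m\<in>UNIV. Gm s s m x * Gm m i l x - Gm s i m x * Gm m s l x)) * Y i x * Y l x) = 0"
proof (rule contracted_ricci_algebra[where h="\<lambda>k i j. pd j (pd i (Y k)) x"])
  have DY: "(Y k has_derivative hderiv (Y k) x) (at x)" for k
    using Ck_open_has_hderiv[OF N Y] .
  have DDY: "(pd i (Y k) has_derivative hderiv (pd i (Y k)) x) (at x)" for i k
    using Ck_open_has_hderiv[OF N Ck_open_pd[OF N(1,2) Y]] .
  have DG: "(Gm l i j has_derivative hderiv (Gm l i j) x) (at x)" for l i j
    using Gm[of l i j] unfolding hderiv_open[OF N] by (simp add: frechet_derivative_works[symmetric])
  show "pd j (pd i (Y k)) x = pd i (pd j (Y k)) x" for k i j
    by (rule pd_commute[OF N Y])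
  show "Gm l i j x = Gm l j i x" for l i j by (rule sym)
  show "(\<Sum>i\<in>UNIV. Y i x * (pd i (Y k) x + (\<Sum>l\<in>UNIV. Gm k i l x * Y l x))) = 0" for k
    by (rule geo[OF N(3)])
  have Dgeo: "((\<lambda>y. \<Sum>i\<in>UNIV. Y i y * (pd i (Y k) y + (\<Sum>l\<in>UNIV. Gm k i l y * Y l y))) has_derivative
       (\<lambda>v. \<Sum>i\<in>UNIV. Y i x * (hderiv (pd i (Y k)) x v + (\<Sum>l\<in>UNIV. Gm k i l x * hderiv (Y l) x v + hderiv (Gm k i l) x v * Y l x))
      + hderiv (Y i) x v * (pd i (Y k) x + (\<Sum>l\<in>UNIV. Gm k i l x * Y l x)))) (at x)" for k
    by (intro has_derivative_sum has_derivative_mult has_derivative_add DY DDY DG)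
  show "(\<Sum>i\<in>UNIV. Y i x * (pd k (pd i (Y k)) x + (\<Sum>l\<in>UNIV. Gm k i l x * pd k (Y l) x + pd k (Gm k i l) x * Y l x))
      + pd k (Y i) x * (pd i (Y k) x + (\<Sum>l\<in>UNIV. Gm k i l x * Y l x))) = 0" for k
    by (rule has_derivative_zero_on_open[OF Dgeo N(1,3) geo])
  have Ddiv: "((\<lambda>y. \<Sum>k\<in>UNIV. pd k (Y k) y + (\<Sum>l\<in>UNIV. Gm k k l y * Y l y)) has_derivative
       (\<lambda>v. \<Sum>k\<in>UNIV. hderiv (pd k (Y k)) x v + (\<Sum>l\<in>UNIV. Gm k k l x * hderiv (Y l) x v + hderiv (Gm k k l) x v * Y l x))) (at x)"
    by (intro has_derivative_sum has_derivative_mult has_derivative_add DY DDY DG)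
  show "(\<Sum>k\<in>UNIV. pd j (pd k (Y k)) x + (\<Sum>l\<in>UNIV. Gm k k l x * pd j (Y l) x + pd j (Gm k k l) x * Y l x)) = 0" for j
    by (rule has_derivative_zero_on_open[OF Ddiv N(1,3) div])
qed


section \<open>Linear algebra at a point\<close>

lemma levi_civita_values:
  "levi_civita 1 2 3 = 1" "levi_civita 2 3 1 = 1" "levi_civita 3 1 2 = 1"
  "levi_civita 1 3 2 = -1" "levi_civita 3 2 1 = -1" "levi_civita 2 1 3 = -1"
  "levi_civita i i k = 0" "levi_civita i k i = 0" "levi_civita k i i = 0"
  using exhaust_3[of i] exhaust_3[of k]
  by (auto simp: levi_civita_def det_3 axis_def)

text \<open>
  The components of the Euclidean volume form with \<open>v\<close> in the last slot; as an endomorphism it is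
  \<open>w \<mapsto> w \<times> v\<close>.
\<close>

definition cross_matrix :: "real^3 \<Rightarrow> real^3^3" where
  "cross_matrix v = (\<chi> i j. \<Sum>k\<in>UNIV. levi_civita i j k * v $ k)"

lemma cross_matrix_nth [simp]:
  "cross_matrix v $ 1 $ 1 = 0" "cross_matrix v $ 1 $ 2 = v $ 3" "cross_matrix v $ 1 $ 3 = - v $ 2"
  "cross_matrix v $ 2 $ 1 = - v $ 3" "cross_matrix v $ 2 $ 2 = 0" "cross_matrix v $ 2 $ 3 = v $ 1"
  "cross_matrix v $ 3 $ 1 = v $ 2" "cross_matrix v $ 3 $ 2 = - v $ 1" "cross_matrix v $ 3 $ 3 = 0"
  by (simp_all add: cross_matrix_def sum_3 levi_civita_values)

lemma transpose_nth [simp]: "transpose A $ i $ j = A $ j $ i"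
  by (simp add: transpose_def)

lemma symmetric_nth: "transpose A = A \<Longrightarrow> A $ i $ j = A $ j $ i"
  by (metis transpose_nth)

lemma matrix_mult_nth3:
  "(A ** B) $ i $ j = A $ i $ 1 * B $ 1 $ j + A $ i $ 2 * B $ 2 $ j + A $ i $ 3 * B $ 3 $ j"
  for A B :: "real^3^3"
  by (simp add: matrix_matrix_mult_def sum_3)

lemma matrix_vector_nth3: "((A :: real^3^3) *v x) $ i = A $ i $ 1 * x $ 1 + A $ i $ 2 * x $ 2 + A $ i $ 3 * x $ 3"
  by (simp add: matrix_vector_mult_def sum_3)

text \<open>
  The behaviour of the Levi-Civita symbol under a change of basis. For a Gram matrix it
  describes lowering the indices of a bivector.
\<close>

lemma cross_matrix_congruence:
  assumes "transpose A = A"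
  shows "A ** cross_matrix (A *v v) ** A = det A *\<^sub>R cross_matrix v"
proof -
  note s = symmetric_nth[OF assms, of 2 1] symmetric_nth[OF assms, of 3 1] symmetric_nth[OF assms, of 3 2]
  show ?thesis unfolding vec_eq_iff forall_3
    by (simp only: matrix_mult_nth3 matrix_vector_nth3 det_3 s cross_matrix_nth vector_scaleR_component
        real_scaleR_def, intro conjI; algebra)
qed

lemma skew_eq_cross_matrix:
  fixes W :: "real^3^3"
  assumes "transpose W = - W"
  shows "2 *\<^sub>R W = cross_matrix (\<chi> k. \<Sum>i\<in>UNIV. \<Sum>j\<in>UNIV. W $ i $ j * levi_civita i j k)"
proof -
  have W: "W $ j $ i = - W $ i $ j" for i j
    using assms by (metis transpose_nth vector_uminus_component)
  have d: "W $ i $ i = 0" for i using W[of i i] by simp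
  show ?thesis unfolding vec_eq_iff forall_3
    by (simp add: sum_3 levi_civita_values d W[of 2 1] W[of 3 1] W[of 3 2])
qed

lemma cross_matrix_self: "cross_matrix v *v v = 0"
  unfolding vec_eq_iff forall_3 by (simp add: matrix_vector_nth3)

lemma cross_matrix_scaleR: "cross_matrix (r *\<^sub>R v) = r *\<^sub>R cross_matrix v"
  unfolding vec_eq_iff forall_3 by simp

lemma trace_cross_matrix_mult: "trace (cross_matrix v ** cross_matrix w) = - 2 * (v \<bullet> w)"
  by (simp add: trace_def sum_3 matrix_mult_nth3 inner_vec_def)

lemma trace_symmetric_skew:
  fixes S P :: "real^'n^'n"
  assumes "transpose S = S" "transpose P = - P"
  shows "trace (S ** P) = 0"
proof -
  have "trace (S ** P) = trace (transpose (S ** P))" by (simp add: trace_def)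
  also have "\<dots> = trace ((- P) ** S)" by (simp add: matrix_transpose_mul assms)
  also have "\<dots> = - trace (P ** S)"
    by (simp add: trace_def matrix_matrix_mult_def sum_negf)
  also have "\<dots> = - trace (S ** P)" by (simp only: trace_mul_sym[of P S])
  finally show ?thesis by simp
qed

lemma symmetric_inverse:
  fixes A B :: "real^'n^'n"
  assumes "transpose A = A" "A ** B = mat 1"
  shows "transpose B = B"
proof -
  have "transpose B ** A = mat 1"
    using assms by (metis matrix_transpose_mul transpose_mat)
  hence "transpose B ** (A ** B) = B"
    by (simp add: matrix_mul_assoc)
  thus ?thesis by (simp add: assms)
qed

lemma matrix_minus_mult: "(- A) ** B = - (A ** B)" "A ** (- B) = - (A ** B)"
  for A B :: "real^'n^'n"
  by (simp_all add: matrix_matrix_mult_def vec_eq_iff sum_negf)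

lemma matrix_mult_diff: "A ** (B - C) = A ** B - A ** C" for A B C :: "real^'n^'n"
  by (simp add: matrix_matrix_mult_def vec_eq_iff right_diff_distrib sum_subtractf)

lemma matrix_scaleR_mult: "(r *\<^sub>R A) ** B = r *\<^sub>R (A ** B)" "A ** (r *\<^sub>R B) = r *\<^sub>R (A ** B)"
  for A B :: "real^'n^'n"
  by (simp_all add: matrix_matrix_mult_def vec_eq_iff sum_distrib_left mult.left_commute mult.assoc)

text \<open>
  Here \<open>T\<close> is the lowered covariant derivative, so that \<open>2 T\<close> is the exterior derivative of the
  1-form. Raising both indices of the skew matrix \<open>T\<close> gives a skew matrix, which is determined by the
  three contractions in the curl equation; lowering the indices again multiplies it by the
  determinant.
\<close>

lemma curl_eigen_gradient:
  fixes G Gi T :: "real^3^3"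
  assumes G: "transpose G = G" "G ** Gi = mat 1" "det G > 0"
    and T: "transpose T = - T"
    and curl: "\<And>k. lam * (G *v Y) $ k = sqrt (det G) / 2 *
      (\<Sum>i\<in>UNIV. \<Sum>j\<in>UNIV. \<Sum>p\<in>UNIV. \<Sum>q\<in>UNIV. Gi $ i $ p * Gi $ j $ q * (2 * T $ p $ q) * levi_civita i j k)"
  shows "Gi ** T ** Gi = (lam / (2 * sqrt (det G))) *\<^sub>R cross_matrix (G *v Y)"
    and "T = (lam * sqrt (det G) / 2) *\<^sub>R cross_matrix Y"
proof -
  have Gi: "transpose Gi = Gi" by (rule symmetric_inverse[OF G(1,2)])
  have Gi': "Gi ** G = mat 1" using G(2) by (simp add: matrix_left_right_inverse)
  define W where "W = Gi ** T ** Gi"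
  define s where "s = sqrt (det G)"
  have s: "s > 0" "s * s = det G" using G(3) by (simp_all add: s_def)
  have "transpose W = - W"
    by (simp add: W_def matrix_transpose_mul Gi T matrix_minus_mult matrix_mul_assoc)
  hence W2: "2 *\<^sub>R W = cross_matrix (\<chi> k. \<Sum>i\<in>UNIV. \<Sum>j\<in>UNIV. W $ i $ j * levi_civita i j k)"
    by (rule skew_eq_cross_matrix)
  (* Gi is symmetric, so the four-fold contraction only sees the raised matrix W. *)
  have Wij: "(\<Sum>p\<in>UNIV. \<Sum>q\<in>UNIV. Gi $ i $ p * Gi $ j $ q * (2 * T $ p $ q) * levi_civita i j k) = 2 * (W $ i $ j * levi_civita i j k)" for i j k
    by (simp add: W_def matrix_mult_nth3 sum_3 symmetric_nth[OF Gi, of j] algebra_simps)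
  have "lam * (G *v Y) $ k = s * (\<Sum>i\<in>UNIV. \<Sum>j\<in>UNIV. W $ i $ j * levi_civita i j k)" for k
    using curl[of k] unfolding Wij s_def[symmetric] sum_distrib_left[symmetric] by simp
  hence "(\<Sum>i\<in>UNIV. \<Sum>j\<in>UNIV. W $ i $ j * levi_civita i j k) = (lam / s) * (G *v Y) $ k" for k
    using s by (simp add: field_simps)
  hence "2 *\<^sub>R W = cross_matrix ((lam / s) *\<^sub>R (G *v Y))"
    unfolding W2 by (intro arg_cong[of _ _ cross_matrix]) (simp add: vec_eq_iff)
  hence "(1/2) *\<^sub>R (2 *\<^sub>R W) = (1/2) *\<^sub>R ((lam / s) *\<^sub>R cross_matrix (G *v Y))"
    by (simp only: cross_matrix_scaleR)
  hence W: "W = (lam / (2 * s)) *\<^sub>R cross_matrix (G *v Y)" by simp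
  thus "Gi ** T ** Gi = (lam / (2 * sqrt (det G))) *\<^sub>R cross_matrix (G *v Y)"
    by (simp add: W_def s_def)
  have "T = G ** W ** G"
    by (simp add: W_def G matrix_mul_assoc) (simp add: matrix_mul_assoc[symmetric] Gi')
  also have "\<dots> = (lam / (2 * s) * det G) *\<^sub>R cross_matrix Y"
    by (simp add: W matrix_scaleR_mult cross_matrix_congruence[OF G(1)])
  also have "lam / (2 * s) * det G = lam * s / 2" using s by (simp add: s(2)[symmetric])
  finally show "T = (lam * sqrt (det G) / 2) *\<^sub>R cross_matrix Y" by (simp add: s_def)
qed

text \<open>
  With \<open>B = \<nabla>Y\<close> as an endomorphism, \<open>transpose B ** G\<close> is \<open>(\<nabla>\<^sub>i \<theta>\<^sub>j)\<close> for the 1-form \<open>\<theta> = g(Y, \<cdot>)\<close>. The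
  two representations by cross products, with indices raised and lowered, are multiplied to get
  the trace of the square; the factors \<open>sqrt (det G)\<close> cancel.
\<close>

lemma curl_eigen_covariant_derivative:
  fixes G Gi B :: "real^3^3"
  assumes G: "transpose G = G" "G ** Gi = mat 1" "det G > 0"
    and T: "transpose (transpose B ** G) = - (transpose B ** G)"
    and curl: "\<And>k. lam * (G *v Y) $ k = sqrt (det G) / 2 *
      (\<Sum>i\<in>UNIV. \<Sum>j\<in>UNIV. \<Sum>p\<in>UNIV. \<Sum>q\<in>UNIV. Gi $ i $ p * Gi $ j $ q * (2 * (transpose B ** G) $ p $ q) * levi_civita i j k)"
  shows "B *v Y = 0" and "trace B = 0" and "trace (B ** B) = - (lam\<^sup>2 / 2) * (Y \<bullet> (G *v Y))"
proof -
  define T where "T = transpose B ** G"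
  have skew: "transpose T = - T" using T by (simp add: T_def)
  have Gi: "transpose Gi = Gi" by (rule symmetric_inverse[OF G(1,2)])
  have "transpose B = T ** Gi" by (simp add: T_def matrix_mul_assoc[symmetric] G(2))
  hence "B = transpose (T ** Gi)" by (metis transpose_transpose)
  hence B: "B = - (Gi ** T)" by (simp add: matrix_transpose_mul Gi skew matrix_minus_mult)
  note W = curl_eigen_gradient[OF G skew curl[folded T_def]]
  have "T *v Y = 0" unfolding W(2)
    by (simp add: scaleR_matrix_vector_assoc[symmetric] cross_matrix_self)
  hence "Gi ** T *v Y = 0" by (simp add: matrix_vector_mul_assoc[symmetric])
  thus "B *v Y = 0" unfolding B by (simp add: matrix_vector_mult_def vec_eq_iff sum_negf)
  have "trace (Gi ** T) = 0" by (rule trace_symmetric_skew[OF Gi skew])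
  thus "trace B = 0" unfolding B by (simp add: trace_def sum_negf)
  have "B ** B = (Gi ** T ** Gi) ** T"
    unfolding B by (simp add: matrix_minus_mult matrix_mul_assoc)
  also have "\<dots> = (lam / (2 * sqrt (det G)) * (lam * sqrt (det G) / 2)) *\<^sub>R (cross_matrix (G *v Y) ** cross_matrix Y)"
    unfolding W(1) by (subst W(2)) (simp add: matrix_scaleR_mult)
  also have "lam / (2 * sqrt (det G)) * (lam * sqrt (det G) / 2) = lam\<^sup>2 / 4"
    using G(3) by (simp add: power2_eq_square)
  finally have "trace (B ** B) = lam\<^sup>2 / 4 * trace (cross_matrix (G *v Y) ** cross_matrix Y)"
    by (simp add: trace_def sum_distrib_left)
  thus "trace (B ** B) = - (lam\<^sup>2 / 2) * (Y \<bullet> (G *v Y))"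
    by (simp add: trace_cross_matrix_mult inner_commute)
qed

lemma skew_if_quadratic_form_zero:
  fixes P :: "real^'n^'n"
  assumes "\<And>u. u \<bullet> (P *v u) = 0"
  shows "transpose P = - P"
proof -
  have b: "axis i 1 \<bullet> (P *v axis j 1) = P $ i $ j" for i j
    by (simp add: inner_axis' matrix_vector_mult_basis column_def)
  have "P $ j $ i = - P $ i $ j" for i j
    using assms[of "axis i 1 + axis j 1"] assms[of "axis i 1"] assms[of "axis j 1"]
    unfolding matrix_vector_right_distrib inner_add_left inner_add_right b by linarith
  thus ?thesis unfolding vec_eq_iff transpose_nth vector_uminus_component by blast
qed

text \<open>
  For the Jacobi operator \<open>S u = R(u, Y) Y\<close> the trace is \<open>Ric(Y, Y)\<close>. Tracing a bilinear form with the
  symmetric inverse metric depends only on its quadratic form, so that form determines the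
  trace.
\<close>

lemma ricci_of_constant_curvature:
  fixes G Gi S :: "real^3^3"
  assumes G: "transpose G = G" "G ** Gi = mat 1"
    and S: "\<And>u. u \<bullet> (G *v (S *v u)) = c * ((u \<bullet> (G *v u)) * (Y \<bullet> (G *v Y)) - (u \<bullet> (G *v Y))\<^sup>2)"
  shows "trace S = 2 * c * (Y \<bullet> (G *v Y))"
proof -
  have Gi: "transpose Gi = Gi" by (rule symmetric_inverse[OF G])
  have Gi': "Gi ** G = mat 1" using G(2) by (simp add: matrix_left_right_inverse)
  define t where "t = G *v Y"
  define q where "q = Y \<bullet> t"
  define Q where "Q = (\<chi> i j. t $ i * t $ j)"
  have Q: "Q *v u = (t \<bullet> u) *\<^sub>R t" for u
    by (simp add: Q_def matrix_vector_nth3 inner_vec_def vec_eq_iff sum_3 algebra_simps)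
  (* P is the defect of the polarised identity; its quadratic form vanishes. *)
  define P where "P = G ** S - c *\<^sub>R (q *\<^sub>R G - Q)"
  have "u \<bullet> (P *v u) = 0" for u
    using S[of u] unfolding P_def
    by (simp add: matrix_vector_mult_diff_rdistrib scaleR_matrix_vector_assoc[symmetric] Q
        matrix_vector_mul_assoc[symmetric] t_def[symmetric] q_def[symmetric] inner_diff_right
        inner_commute[of t] power2_eq_square algebra_simps)
  hence "transpose P = - P" by (rule skew_if_quadratic_form_zero)
  hence "0 = trace (Gi ** P)" using trace_symmetric_skew[OF Gi] by simp
  also have "\<dots> = trace (Gi ** G ** S) - c * (q * trace (Gi ** G) - trace (Gi ** Q))"
    by (simp add: P_def matrix_mult_diff matrix_scaleR_mult matrix_mul_assoc)
       (simp add: trace_def sum_subtractf sum_distrib_left right_diff_distrib)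
  also have "trace (Gi ** Q) = t \<bullet> (Gi *v t)"
    by (simp add: Q_def trace_def sum_3 matrix_mult_nth3 matrix_vector_nth3 inner_vec_def algebra_simps)
  also have "Gi *v t = Y" by (simp add: t_def matrix_vector_mul_assoc Gi')
  also have "trace (Gi ** G) = 3" by (simp add: Gi' trace_def mat_def)
  finally show ?thesis unfolding Gi' t_def[symmetric] q_def[symmetric]
    by (simp add: inner_commute[of t] q_def[symmetric])
qed

text \<open>
  The test vectors are those of Sylvester's criterion: the last one is the last column of the
  adjugate, on which \<open>G\<close> acts as \<open>det G\<close> times the third unit vector.
\<close>

lemma det_pos_if_positive_definite:
  fixes G :: "real^3^3"
  assumes sym: "transpose G = G" and pos: "\<And>u. u \<noteq> 0 \<Longrightarrow> u \<bullet> (G *v u) > 0"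
  shows "det G > 0"
proof -
  note s = symmetric_nth[OF sym, of 2 1] symmetric_nth[OF sym, of 3 1] symmetric_nth[OF sym, of 3 2]
  define m where "m = G $ 1 $ 1 * G $ 2 $ 2 - G $ 1 $ 2 * G $ 1 $ 2"
  have nz: "vector [a, b, c] \<noteq> (0 :: real^3) \<longleftrightarrow> a \<noteq> 0 \<or> b \<noteq> 0 \<or> c \<noteq> 0" for a b c
    by (auto simp: vec_eq_iff forall_3)
  have g: "G $ 1 $ 1 > 0"
    using pos[of "vector [1, 0, 0]"] by (simp add: nz inner_vec_def sum_3 matrix_vector_nth3)
  have "G $ 1 $ 1 * m > 0"
    using pos[of "vector [- G $ 1 $ 2, G $ 1 $ 1, 0]"] g
    by (simp add: nz inner_vec_def sum_3 matrix_vector_nth3 s m_def algebra_simps)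
  hence m: "m > 0" using g by (simp add: zero_less_mult_iff)
  have "det G * m > 0"
    using pos[of "vector [G $ 1 $ 2 * G $ 2 $ 3 - G $ 1 $ 3 * G $ 2 $ 2, G $ 1 $ 2 * G $ 1 $ 3 - G $ 1 $ 1 * G $ 2 $ 3, m]"] m
    by (simp add: nz inner_vec_def sum_3 matrix_vector_nth3 det_3 s) (simp add: m_def algebra_simps)
  thus ?thesis using m by (simp add: zero_less_mult_iff)
qed

lemma matrix_inv_mult:
  fixes A :: "real^'n^'n"
  assumes "det A \<noteq> 0"
  shows "A ** matrix_inv A = mat 1" "matrix_inv A ** A = mat 1"
proof -
  have "\<exists>B. A ** B = mat 1 \<and> B ** A = mat 1"
    using assms unfolding invertible_det_nz[symmetric] invertible_def .
  hence "A ** matrix_inv A = mat 1 \<and> matrix_inv A ** A = mat 1"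
    unfolding matrix_inv_def by (rule someI_ex)
  thus "A ** matrix_inv A = mat 1" "matrix_inv A ** A = mat 1" by blast+
qed

lemma matrix_inv_nth:
  fixes A :: "real^'n^'n"
  assumes "det A \<noteq> 0"
  shows "matrix_inv A $ l $ m = det (\<chi> i j. if j = l then axis m 1 $ i else A $ i $ j) / det A"
proof -
  have "A *v (matrix_inv A *v axis m 1) = axis m 1"
    by (simp add: matrix_vector_mul_assoc matrix_inv_mult[OF assms])
  hence "matrix_inv A *v axis m 1 = (\<chi> k. det (\<chi> i j. if j = k then axis m 1 $ i else A $ i $ j) / det A)"
    by (simp add: cramer[OF assms])
  moreover have "(matrix_inv A *v axis m 1) $ l = matrix_inv A $ l $ m"
    by (simp add: matrix_vector_mult_basis column_def)
  ultimately show ?thesis by simp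
qed


section \<open>Christoffel symbols and covariant derivatives\<close>

lemma Ck_open_nth:
  fixes f :: "real^3 \<Rightarrow> 'b::real_normed_vector ^ 'n"
  assumes "open N" "Ck_open k N f"
  shows "Ck_open k N (\<lambda>y. f y $ i)"
  using Ck_open_bounded_linear[OF bounded_linear_vec_nth assms] .

lemma Ck_open_differentiable:
  assumes "open N" "x \<in> N" "Ck_open (Suc k) N f"
  shows "f differentiable (at x)"
  using assms by (simp add: differentiable_on_def at_within_open_NO_MATCH)

lemma differentiable_transform_open:
  assumes "f differentiable (at x)" "open N" "x \<in> N" "\<And>y. y \<in> N \<Longrightarrow> f y = h y"
  shows "h differentiable (at x)"
  using assms has_derivative_transform_within_open unfolding differentiable_def by blast

lemma matrix_inv_differentiable:
  fixes G :: "real^3 \<Rightarrow> real^3^3"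
  assumes N: "open N" "x \<in> N" and det: "\<And>y. y \<in> N \<Longrightarrow> det (G y) \<noteq> 0"
    and G: "\<And>i j. (\<lambda>y. G y $ i $ j) differentiable (at x)"
  shows "(\<lambda>y. matrix_inv (G y) $ l $ m) differentiable (at x)"
proof (rule differentiable_transform_open[OF _ N])
  show "det (\<chi> i j. if j = l then axis m 1 $ i else G y $ i $ j) / det (G y) = matrix_inv (G y) $ l $ m"
    if "y \<in> N" for y
    by (rule matrix_inv_nth[OF det[OF that], symmetric])
  have e: "(\<lambda>y. if P then r else G y $ i $ j) differentiable (at x)" for P r i j
    using G by (cases P) simp_all
  have d: "(\<lambda>y. det (G y)) differentiable (at x)"
    unfolding det_3 by (intro differentiable_add differentiable_diff differentiable_mult G)
  show "(\<lambda>y. det (\<chi> i j. if j = l then axis m 1 $ i else G y $ i $ j) / det (G y)) differentiable (at x)"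
    unfolding det_3[of "\<chi> i j. _ i j"] vec_lambda_beta
    by (intro differentiable_divide differentiable_add differentiable_diff differentiable_mult e d det N)
qed

text \<open>
  By Cramer's rule the inverse metric is a rational function of the entries of \<open>G\<close>.
\<close>

lemma christoffel_differentiable:
  fixes G :: "real^3 \<Rightarrow> real^3^3"
  assumes N: "open N" "N \<subseteq> half_space" "x \<in> N" and det: "\<And>y. y \<in> N \<Longrightarrow> det (G y) \<noteq> 0"
    and G: "Ck_open (Suc (Suc 0)) N G"
  shows "christoffel G l i j differentiable (at x)"
proof -
  have e: "Ck_open (Suc (Suc 0)) N (\<lambda>y. G y $ i $ j)" for i j
    by (intro Ck_open_nth N G)
  have g: "(\<lambda>y. G y $ i $ j) differentiable (at x)" for i j
    by (rule Ck_open_differentiable[OF N(1,3) e])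
  have d: "pd k (\<lambda>y. G y $ i $ j) differentiable (at x)" for i j k
    by (rule Ck_open_differentiable[OF N(1,3) Ck_open_pd[OF N(1,2) e]])
  have "(\<lambda>y. (\<Sum>m\<in>UNIV. matrix_inv (G y) $ l $ m *
     (pd i (\<lambda>y. G y $ j $ m) y + pd j (\<lambda>y. G y $ i $ m) y - pd m (\<lambda>y. G y $ i $ j) y)) / 2)
     differentiable (at x)"
    unfolding sum_3
    by (intro differentiable_divide differentiable_add differentiable_diff differentiable_mult d
        matrix_inv_differentiable[OF N(1,3) det] g differentiable_const) simp_all
  thus ?thesis unfolding christoffel_def[abs_def] .
qed

text \<open>
  The row is the component and the column the direction of differentiation: this is the matrix of
  \<open>v \<mapsto> \<nabla>\<^sub>v Y\<close>, and applying it to \<open>Y\<close> gives \<open>\<nabla>\<^sub>Y Y\<close>.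
\<close>

definition nabla :: "(real^3 \<Rightarrow> real^3^3) \<Rightarrow> (real^3 \<Rightarrow> real^3) \<Rightarrow> real^3 \<Rightarrow> real^3^3" where
  "nabla G Y x = (\<chi> k i. pd i (\<lambda>y. Y y $ k) x + (\<Sum>l\<in>UNIV. christoffel G k i l x * Y x $ l))"

lemma flat_eq: "transpose (G x) = G x \<Longrightarrow> flat G Y x = G x *v Y x"
  by (simp add: flat_def matrix_vector_mult_def vec_eq_iff symmetric_nth[of "G x"])

lemma pd_cong:
  assumes "open N" "N \<subseteq> half_space" "x \<in> N" "f differentiable (at x)" "\<And>y. y \<in> N \<Longrightarrow> f y = h y"
  shows "pd i f x = pd i h x"
  unfolding hderiv_open[OF assms(1-3)]
  by (simp add: frechet_derivative_transform_within_open[OF assms(4,1,3,5)])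

lemma christoffel_lowered:
  assumes "transpose (G x) = G x" "det (G x) \<noteq> 0"
  shows "(\<Sum>l\<in>UNIV. G x $ l $ k * christoffel G l i j x) =
    (pd i (\<lambda>y. G y $ j $ k) x + pd j (\<lambda>y. G y $ i $ k) x - pd k (\<lambda>y. G y $ i $ j) x) / 2"
proof -
  define D where "D = (\<chi> m. pd i (\<lambda>y. G y $ j $ m) x + pd j (\<lambda>y. G y $ i $ m) x - pd m (\<lambda>y. G y $ i $ j) x)"
  have c: "christoffel G l i j x = (matrix_inv (G x) *v D) $ l / 2" for l
    by (simp add: christoffel_def matrix_vector_mult_def D_def)
  have "(\<Sum>l\<in>UNIV. G x $ l $ k * christoffel G l i j x) = (G x *v (matrix_inv (G x) *v D)) $ k / 2"
    unfolding c matrix_vector_mult_def[of "G x"]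
    by (simp add: symmetric_nth[OF assms(1), of k] sum_divide_distrib)
  also have "G x *v (matrix_inv (G x) *v D) = D"
    by (simp add: matrix_vector_mul_assoc matrix_inv_mult[OF assms(2)])
  finally show ?thesis by (simp add: D_def)
qed

lemma christoffel_symmetric:
  assumes "\<And>m. pd m (\<lambda>y. G y $ i $ j) x = pd m (\<lambda>y. G y $ j $ i) x"
  shows "christoffel G l i j x = christoffel G l j i x"
  unfolding christoffel_def assms by (simp add: add.commute)

text \<open>
  Metric compatibility: lowering an index commutes with covariant differentiation.
\<close>

lemma covariant_deriv_flat:
  fixes G :: "real^3 \<Rightarrow> real^3^3" and Y :: "real^3 \<Rightarrow> real^3"
  assumes N: "open N" "N \<subseteq> half_space" "x \<in> N"
    and sym: "\<And>y. y \<in> N \<Longrightarrow> transpose (G y) = G y" and det: "det (G x) \<noteq> 0"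
    and G: "Ck_open (Suc k) N G" and Y: "Ck_open (Suc m) N Y"
  shows "covariant_deriv1 G (flat G Y) i j x = (transpose (nabla G Y x) ** G x) $ i $ j"
proof -
  have DG: "((\<lambda>y. G y $ p $ q) has_derivative hderiv (\<lambda>y. G y $ p $ q) x) (at x)" for p q
    by (rule Ck_open_has_hderiv[OF N Ck_open_nth[OF N(1) Ck_open_nth[OF N(1) G]]])
  have DY: "((\<lambda>y. Y y $ p) has_derivative hderiv (\<lambda>y. Y y $ p) x) (at x)" for p
    by (rule Ck_open_has_hderiv[OF N Ck_open_nth[OF N(1) Y]])
  have dsym: "pd r (\<lambda>y. G y $ p $ q) x = pd r (\<lambda>y. G y $ q $ p) x" for p q r
    by (rule pd_cong[OF N differentiableI[OF DG]]) (rule symmetric_nth[OF sym])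
  have "((\<lambda>y. \<Sum>p\<in>UNIV. G y $ p $ j * Y y $ p) has_derivative
     (\<lambda>v. \<Sum>p\<in>UNIV. G x $ p $ j * hderiv (\<lambda>y. Y y $ p) x v + hderiv (\<lambda>y. G y $ p $ j) x v * Y x $ p)) (at x)"
    by (intro has_derivative_sum has_derivative_mult DG DY)
  note fd = frechet_derivative_at[OF this, symmetric]
  have d: "pd i (\<lambda>y. flat G Y y $ j) x
      = (\<Sum>p\<in>UNIV. G x $ p $ j * pd i (\<lambda>y. Y y $ p) x + pd i (\<lambda>y. G y $ p $ j) x * Y x $ p)"
    unfolding flat_def vec_lambda_beta by (subst hderiv_open[OF N]) (subst fd, rule refl)
  have c: "(\<Sum>l\<in>UNIV. christoffel G l i j x * flat G Y x $ l) =
     (\<Sum>p\<in>UNIV. Y x $ p * (\<Sum>l\<in>UNIV. G x $ l $ p * christoffel G l i j x))"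
    by (simp add: flat_def sum_3 symmetric_nth[OF sym[OF N(3)], of 2 1]
       symmetric_nth[OF sym[OF N(3)], of 3 1] symmetric_nth[OF sym[OF N(3)], of 3 2] algebra_simps)
  have n: "(transpose (nabla G Y x) ** G x) $ i $ j = (\<Sum>p\<in>UNIV. G x $ p $ j * pd i (\<lambda>y. Y y $ p) x)
     + (\<Sum>l\<in>UNIV. Y x $ l * (\<Sum>p\<in>UNIV. G x $ p $ j * christoffel G p i l x))"
    by (simp add: matrix_mult_nth3 nabla_def sum_3 algebra_simps)
  have "(\<Sum>p\<in>UNIV. pd i (\<lambda>y. G y $ p $ j) x * Y x $ p)
      - (\<Sum>p\<in>UNIV. Y x $ p * ((pd i (\<lambda>y. G y $ j $ p) x + pd j (\<lambda>y. G y $ i $ p) x - pd p (\<lambda>y. G y $ i $ j) x) / 2))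
      = (\<Sum>l\<in>UNIV. Y x $ l * ((pd i (\<lambda>y. G y $ l $ j) x + pd l (\<lambda>y. G y $ i $ j) x - pd j (\<lambda>y. G y $ i $ l) x) / 2))"
    unfolding sum_subtractf[symmetric] dsym[of _ j] by (intro sum.cong refl) (simp add: field_simps)
  thus ?thesis
    unfolding covariant_deriv1_def d c n christoffel_lowered[where G=G and x=x, OF sym[OF N(3)] det]
    by (simp add: sum.distrib)
qed


section \<open>Curvature from a curl eigenfield\<close>

lemma inner_at_eq:
  assumes "transpose (G x) = G x"
  shows "inner_at G x u v = u \<bullet> (G x *v v)" "inner_at G x u v = v \<bullet> (G x *v u)"
proof -
  show "inner_at G x u v = u \<bullet> (G x *v v)"
    by (simp add: inner_at_def inner_vec_def matrix_vector_mult_def sum_distrib_left algebra_simps)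
  thus "inner_at G x u v = v \<bullet> (G x *v u)"
    by (metis assms dot_lmul_matrix inner_commute transpose_matrix_vector)
qed

text \<open>
  The matrix of the Jacobi operator \<open>u \<mapsto> R(u, w) w\<close>; its trace is \<open>Ric(w, w)\<close>.
\<close>

definition jacobi_matrix :: "(real^3 \<Rightarrow> real^3^3) \<Rightarrow> real^3 \<Rightarrow> real^3 \<Rightarrow> real^3^3" where
  "jacobi_matrix G x w = (\<chi> l i. \<Sum>j\<in>UNIV. \<Sum>k\<in>UNIV. riemann G l k i j x * w $ j * w $ k)"

lemma curvature_op_jacobi: "curvature_op G x u w w = jacobi_matrix G x w *v u"
  by (simp add: vec_eq_iff curvature_op_def jacobi_matrix_def matrix_vector_mult_def sum_distrib_right sum_distrib_left mult.assoc mult.left_commute mult.commute)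

lemma jacobi_matrix_self: "jacobi_matrix G x w *v w = 0"
proof -
  have r: "riemann G l k i j x = - riemann G l k j i x" for l k i j
    by (simp add: riemann_def sum_subtractf)
  have r0: "riemann G l k i i x = 0" for l k i
    using r[of l k i i] by simp
  show ?thesis
    by (simp add: vec_eq_iff jacobi_matrix_def matrix_vector_mult_def sum_3 r0
        r[of _ _ 2 1] r[of _ _ 3 1] r[of _ _ 3 2] algebra_simps)
qed

text \<open>
  The sectional curvature determines the quadratic form of the Jacobi operator off the line
  spanned by \<open>w\<close>; on that line both sides vanish. Off the line, the strict Cauchy-Schwarz
  inequality keeps the denominator of the sectional curvature from being zero.
\<close>

lemma jacobi_quadratic_form:
  assumes sym: "transpose (G x) = G x" and pos: "\<And>u. u \<noteq> 0 \<Longrightarrow> u \<bullet> (G x *v u) > 0"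
    and curv: "\<And>u v. u \<noteq> v \<Longrightarrow> independent {u, v} \<Longrightarrow> sectional_curvature G x u v = c"
    and w: "w \<noteq> 0"
  shows "u \<bullet> (G x *v (jacobi_matrix G x w *v u))
    = c * ((u \<bullet> (G x *v u)) * (w \<bullet> (G x *v w)) - (u \<bullet> (G x *v w))\<^sup>2)"
proof (cases "u \<in> span {w}")
  case True
  then obtain t where u: "u = t *\<^sub>R w" by (auto simp: span_singleton)
  show ?thesis
    by (simp add: u matrix_vector_mult_scaleR jacobi_matrix_self power2_eq_square)
next
  case False
  have ne: "u \<noteq> w" using False span_base by blast
  have ind: "independent {u, w}"
    using False w by (intro independent_insertI) (auto simp: independent_empty)
  (* t *R w is the orthogonal projection of u to the line spanned by w. *)
  define t where "t = (u \<bullet> (G x *v w)) / (w \<bullet> (G x *v w))"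
  have ww: "w \<bullet> (G x *v w) > 0" by (rule pos[OF w])
  have wu: "w \<bullet> (G x *v u) = u \<bullet> (G x *v w)"
    using inner_at_eq[where G=G and x=x, OF sym, of u w] by simp
  have "u - t *\<^sub>R w \<noteq> 0" using False by (metis eq_iff_diff_eq_0 singletonI span_base span_scale)
  hence "(u - t *\<^sub>R w) \<bullet> (G x *v (u - t *\<^sub>R w)) > 0" by (rule pos)
  hence "0 < u \<bullet> (G x *v u) - 2 * t * (u \<bullet> (G x *v w)) + t * t * (w \<bullet> (G x *v w))"
    by (simp add: matrix_vector_mult_diff_distrib matrix_vector_mult_scaleR inner_diff_left inner_diff_right wu algebra_simps)
  hence "0 < (u \<bullet> (G x *v u) - 2 * t * (u \<bullet> (G x *v w)) + t * t * (w \<bullet> (G x *v w)))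
      * (w \<bullet> (G x *v w))"
    using ww by (rule mult_pos_pos)
  also have "\<dots> = (u \<bullet> (G x *v u)) * (w \<bullet> (G x *v w))
      - 2 * (t * (w \<bullet> (G x *v w))) * (u \<bullet> (G x *v w)) + (t * (w \<bullet> (G x *v w)))\<^sup>2"
    by (simp add: algebra_simps power2_eq_square)
  also have "t * (w \<bullet> (G x *v w)) = u \<bullet> (G x *v w)" using ww by (simp add: t_def)
  finally have d: "(u \<bullet> (G x *v u)) * (w \<bullet> (G x *v w)) - (u \<bullet> (G x *v w))\<^sup>2 > 0"
    by (simp add: power2_eq_square)
  have "u \<bullet> (G x *v (jacobi_matrix G x w *v u)) /
      ((u \<bullet> (G x *v u)) * (w \<bullet> (G x *v w)) - (u \<bullet> (G x *v w))\<^sup>2) = c"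
    using curv[OF ne ind]
    unfolding sectional_curvature_def curvature_op_jacobi inner_at_eq(1)[where G=G and x=x, OF sym, of u] inner_at_eq(1)[where G=G and x=x, OF sym, of w]
      inner_at_eq(2)[where G=G and x=x, OF sym, of _ u] .
  thus ?thesis using d by (simp add: field_simps)
qed

text \<open>
  The local theorem in one chart: the contracted Ricci identity for \<open>Y\<close> reads
  \<open>(2 c - lam\<^sup>2/2) |Y|\<^sup>2 = 0\<close>, and \<open>|Y|\<^sup>2\<close> is positive at \<open>x\<close>.
\<close>

lemma curl_eigenfield_curvature:
  fixes G :: "real^3 \<Rightarrow> real^3^3" and Y :: "real^3 \<Rightarrow> real^3"
  assumes N: "open N" "N \<subseteq> half_space" "x \<in> N"
    and sym: "\<And>y. y \<in> N \<Longrightarrow> transpose (G y) = G y"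
    and pos: "\<And>y u. y \<in> N \<Longrightarrow> u \<noteq> 0 \<Longrightarrow> u \<bullet> (G y *v u) > 0"
    and G: "Ck_open (Suc (Suc 0)) N G" and Y: "Ck_open (Suc (Suc 0)) N Y"
    and killing: "\<And>y i j. y \<in> N \<Longrightarrow>
       covariant_deriv1 G (flat G Y) i j y + covariant_deriv1 G (flat G Y) j i y = 0"
    and curl: "\<And>y. y \<in> N \<Longrightarrow> flat G (\<lambda>y. lam *\<^sub>R Y y) y = hodge2 G (ext_deriv1 (flat G Y)) y"
    and curv: "\<And>u v. u \<noteq> v \<Longrightarrow> independent {u, v} \<Longrightarrow> sectional_curvature G x u v = c"
    and Yx: "Y x \<noteq> 0"
  shows "c = lam\<^sup>2 / 4"
proof -
  have det: "det (G y) > 0" if "y \<in> N" for y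
    by (rule det_pos_if_positive_definite[OF sym[OF that] pos[OF that]])
  have det0: "det (G y) \<noteq> 0" if "y \<in> N" for y
    using det[OF that] by simp
  have dsym: "christoffel G l i j y = christoffel G l j i y" if "y \<in> N" for l i j y
  proof (rule christoffel_symmetric)
    show "pd m (\<lambda>y. G y $ i $ j) y = pd m (\<lambda>y. G y $ j $ i) y" for m
      by (rule pd_cong[OF N(1,2) that Ck_open_differentiable[OF N(1) that Ck_open_nth[OF N(1) Ck_open_nth[OF N(1) G]]]])
         (rule symmetric_nth[OF sym])
  qed
  have cov: "covariant_deriv1 G (flat G Y) i j y = (transpose (nabla G Y y) ** G y) $ i $ j"
    if "y \<in> N" for i j y
    by (rule covariant_deriv_flat[OF N(1,2) that sym det0[OF that] G Y])
  have skew: "(transpose (nabla G Y y) ** G y) $ j $ i = - (transpose (nabla G Y y) ** G y) $ i $ j"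
    if "y \<in> N" for i j y
    using killing[OF that, of i j] unfolding cov[OF that] by linarith
  have ext: "ext_deriv1 (flat G Y) y $ p $ q = 2 * (transpose (nabla G Y y) ** G y) $ p $ q"
    if "y \<in> N" for p q y
  proof -
    have "ext_deriv1 (flat G Y) y $ p $ q
        = covariant_deriv1 G (flat G Y) p q y - covariant_deriv1 G (flat G Y) q p y"
      by (simp add: ext_deriv1_def covariant_deriv1_def dsym[OF that, of _ q p])
    thus ?thesis using cov[OF that] skew[OF that, of p q] by simp
  qed
  have Tskew: "transpose (transpose (nabla G Y y) ** G y) = - (transpose (nabla G Y y) ** G y)"
    if "y \<in> N" for y
    unfolding vec_eq_iff transpose_nth vector_uminus_component using skew[OF that] by blast
  have curl': "lam * (G y *v Y y) $ k = sqrt (det (G y)) / 2 *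
      (\<Sum>i\<in>UNIV. \<Sum>j\<in>UNIV. \<Sum>p\<in>UNIV. \<Sum>q\<in>UNIV. matrix_inv (G y) $ i $ p * matrix_inv (G y) $ j $ q
        * (2 * (transpose (nabla G Y y) ** G y) $ p $ q) * levi_civita i j k)" if "y \<in> N" for y k
  proof -
    have "lam * (G y *v Y y) $ k = flat G (\<lambda>y. lam *\<^sub>R Y y) y $ k"
      by (simp add: flat_eq sym[OF that] matrix_vector_mult_scaleR)
    thus ?thesis unfolding curl[OF that] hodge2_def ext[OF that] vec_lambda_beta .
  qed
  note nab = curl_eigen_covariant_derivative[OF sym matrix_inv_mult(1)[OF det0] det Tskew curl']
  have nabla_nth: "nabla G Y y $ k $ i = pd i (\<lambda>y. Y y $ k) y + (\<Sum>l\<in>UNIV. christoffel G k i l y * Y y $ l)" for y k i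
    by (simp add: nabla_def)
  define q where "q = Y x \<bullet> (G x *v Y x)"
  have q: "q > 0" unfolding q_def by (rule pos[OF N(3) Yx])
  have "trace (nabla G Y x ** nabla G Y x) + trace (jacobi_matrix G x (Y x)) = 0"
  proof -
    have "(\<Sum>i\<in>UNIV. \<Sum>k\<in>UNIV. nabla G Y x $ k $ i * nabla G Y x $ i $ k)
     + (\<Sum>i\<in>UNIV. \<Sum>l\<in>UNIV. (\<Sum>s\<in>UNIV. riemann G s l s i x) * Y x $ i * Y x $ l) = 0"
      unfolding nabla_nth riemann_def
    proof (rule contracted_ricci_identity[OF N, of "\<lambda>k y. Y y $ k" "christoffel G"])
      show "Ck_open (Suc (Suc 0)) N (\<lambda>y. Y y $ k)" for k by (rule Ck_open_nth[OF N(1) Y])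
      show "christoffel G l i j differentiable (at x)" for l i j
        by (rule christoffel_differentiable[OF N det0 G])
      show "christoffel G l i j x = christoffel G l j i x" for l i j by (rule dsym[OF N(3)])
      show "(\<Sum>i\<in>UNIV. Y y $ i * (pd i (\<lambda>y. Y y $ k) y + (\<Sum>l\<in>UNIV. christoffel G k i l y * Y y $ l))) = 0"
        if "y \<in> N" for y k
        using arg_cong[OF nab(1)[OF that that that that that], of "\<lambda>v. v $ k"]
        unfolding nabla_nth[symmetric] by (simp add: matrix_vector_mult_def mult.commute)
      show "(\<Sum>k\<in>UNIV. pd k (\<lambda>y. Y y $ k) y + (\<Sum>l\<in>UNIV. christoffel G k k l y * Y y $ l)) = 0"
        if "y \<in> N" for y
        using nab(2)[OF that that that that that] unfolding trace_def nabla_nth .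
    qed
    moreover have "trace (nabla G Y x ** nabla G Y x) = (\<Sum>i\<in>UNIV. \<Sum>k\<in>UNIV. nabla G Y x $ k $ i * nabla G Y x $ i $ k)"
      by (simp add: trace_def matrix_matrix_mult_def mult.commute)
    moreover have "trace (jacobi_matrix G x (Y x)) = (\<Sum>i\<in>UNIV. \<Sum>l\<in>UNIV. (\<Sum>s\<in>UNIV. riemann G s l s i x) * Y x $ i * Y x $ l)"
      by (simp add: trace_def jacobi_matrix_def sum_3 algebra_simps)
    ultimately show ?thesis by simp
  qed
  moreover have "trace (jacobi_matrix G x (Y x)) = 2 * c * q"
    unfolding q_def
    by (rule ricci_of_constant_curvature[OF sym[OF N(3)] matrix_inv_mult(1)[OF det0[OF N(3)]]])
       (rule jacobi_quadratic_form[where G=G and x=x, OF sym[OF N(3)] pos[OF N(3)] curv Yx])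
  moreover have "trace (nabla G Y x ** nabla G Y x) = - (lam\<^sup>2 / 2) * q"
    unfolding q_def by (rule nab(3)[OF N(3) N(3) N(3) N(3) N(3)])
  ultimately have "(2 * c - lam\<^sup>2 / 2) * q = 0" by (simp add: algebra_simps)
  thus ?thesis using q by simp
qed


section \<open>Charts, tangent vectors and the Gram matrix\<close>

lemma at_within_openin:
  assumes "openin (top_of_set H) S" "x \<in> S"
  shows "at x within S = at x within H"
proof -
  obtain T where T: "open T" "S = H \<inter> T" using assms(1) by (auto simp: openin_open)
  show ?thesis using assms(2) T by (intro at_within_nhd[of x T]) auto
qed

text \<open>
  Every point of the half-space can be left along each coordinate axis in the positive direction
  without leaving the half-space, so one-sided derivatives at the boundary are unique as well.
\<close>

lemma hderiv_unique:
  assumes "x \<in> half_space" "(f has_derivative f') (at x within half_space)"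
  shows "hderiv f x = f'"
proof (rule frechet_derivative_unique_within)
  show "(f has_derivative hderiv f x) (at x within half_space)"
    using assms(2) differentiableI frechet_derivative_works by blast
  show "(f has_derivative f') (at x within half_space)" by fact
  fix i :: "real^3" and e :: real assume "i \<in> Basis" "e > 0"
  then obtain k where "i = axis k 1" by (auto simp: Basis_vec_def)
  hence "x + (e / 2) *\<^sub>R i \<in> half_space"
    using assms(1) \<open>e > 0\<close> by (simp add: half_space_def axis_def)
  thus "\<exists>d. 0 < \<bar>d\<bar> \<and> \<bar>d\<bar> < e \<and> x + d *\<^sub>R i \<in> half_space"
    using \<open>e > 0\<close> by (intro exI[of _ "e / 2"]) auto
qed

lemma hderiv_transform:
  assumes "openin (top_of_set half_space) S" "x \<in> S"
    and "(f has_derivative f') (at x within S)" "\<And>y. y \<in> S \<Longrightarrow> h y = f y"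
  shows "hderiv h x = f'"
proof (rule hderiv_unique)
  show "x \<in> half_space" using assms(1,2) openin_imp_subset by blast
  have "(h has_derivative f') (at x within S)"
    by (rule has_derivative_transform[OF assms(2) assms(4) assms(3)])
  thus "(h has_derivative f') (at x within half_space)"
    by (simp add: at_within_openin[OF assms(1,2)])
qed

lemma smooth_on_has_hderiv:
  assumes "smooth_on S f" "openin (top_of_set half_space) S" "x \<in> S"
  shows "(f has_derivative hderiv f x) (at x within half_space)"
proof -
  from bspec[OF assms(1)[unfolded smooth_on_def] assms(3)]
  obtain U F where UF: "open U \<and> x \<in> U \<and> (\<forall>k. Ck_open k U F) \<and> (\<forall>y\<in>S \<inter> U. F y = f y)"
    by (elim exE) (rule that)
  hence U: "open U" "x \<in> U" "Ck_open (Suc 0) U F" "y \<in> S \<inter> U \<Longrightarrow> F y = f y" for y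
    by blast+
  have "F differentiable (at x)"
    by (rule Ck_open_differentiable[OF U(1,2) U(3)])
  then obtain F' where "(F has_derivative F') (at x)" unfolding differentiable_def by blast
  hence "(F has_derivative F') (at x within S \<inter> U)" by (rule has_derivative_at_withinI)
  hence "(f has_derivative F') (at x within S \<inter> U)"
    using assms(3) U by (intro has_derivative_transform[of x "S \<inter> U" f F]) auto
  moreover have "openin (top_of_set half_space) (S \<inter> U)"
    using assms(2) U(1) by (simp add: openin_Int_open)
  ultimately have "(f has_derivative F') (at x within half_space)"
    using at_within_openin[of half_space "S \<inter> U" x] assms(3) U(2) by simp
  thus ?thesis using differentiableI frechet_derivative_works by blast
qed

context
  fixes M :: "'m topology" and A :: "'m chart set"
  assumes mfd: "oriented_smooth_manifold3 M A"
begin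

lemma chart_facts:
  assumes "c \<in> A"
  shows "openin M (fst c)" "openin (top_of_set half_space) (chart_image c)"
    "homeomorphic_map (subtopology M (fst c)) (top_of_set (chart_image c)) (snd c)"
    "inj_on (snd c) (fst c)"
proof -
  show 1: "openin M (fst c)" and "openin (top_of_set half_space) (chart_image c)"
    and h: "homeomorphic_map (subtopology M (fst c)) (top_of_set (chart_image c)) (snd c)"
    using mfd assms by (auto simp: oriented_smooth_manifold3_def boundary_chart_def)
  have "topspace (subtopology M (fst c)) = fst c"
    using openin_subset[OF 1] by auto
  thus "inj_on (snd c) (fst c)" using homeomorphic_imp_injective_map[OF h] by simp
qed

lemma local_rep_chart [simp]:
  assumes "c \<in> A" "p \<in> fst c"
  shows "local_rep c F (snd c p) = F p"
  using chart_facts(4)[OF assms(1)] assms(2) by (simp add: local_rep_def)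

lemma openin_chart_image:
  assumes "c \<in> A" "openin M V"
  shows "openin (top_of_set half_space) (snd c ` (fst c \<inter> V))"
proof -
  have "openin (subtopology M (fst c)) (fst c \<inter> V)"
    using assms(2) by (auto simp: openin_subtopology)
  hence "openin (top_of_set (chart_image c)) (snd c ` (fst c \<inter> V))"
    using homeomorphic_imp_open_map[OF chart_facts(3)[OF assms(1)]] by (simp add: open_map_def)
  thus ?thesis using chart_facts(2)[OF assms(1)] openin_trans by blast
qed

lemma transition_has_hderiv:
  assumes "c \<in> charts_at A p" "d \<in> charts_at A p"
  shows "(transition c d has_derivative hderiv (transition c d) (snd c p)) (at (snd c p) within half_space)"
proof (rule smooth_on_has_hderiv)
  show "smooth_on (snd c ` (fst c \<inter> fst d)) (transition c d)"
    using mfd assms by (simp add: oriented_smooth_manifold3_def charts_at_def)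
  show "openin (top_of_set half_space) (snd c ` (fst c \<inter> fst d))"
    using assms by (intro openin_chart_image chart_facts) (auto simp: charts_at_def)
  show "snd c p \<in> snd c ` (fst c \<inter> fst d)" using assms by (simp add: charts_at_def)
qed

text \<open>
  The cocycle condition that makes coordinate vectors tangent vectors. One-sided derivatives are
  unique by \<open>hderiv_unique\<close>, so the chain rule holds at interior and boundary points alike.
\<close>

lemma transition_chain_rule:
  assumes "c \<in> charts_at A p" "d \<in> charts_at A p" "e \<in> charts_at A p"
  shows "hderiv (transition c e) (snd c p) v
    = hderiv (transition d e) (snd d p) (hderiv (transition c d) (snd c p) v)"
proof -
  have A: "c \<in> A" "d \<in> A" "e \<in> A" and p: "p \<in> fst c" "p \<in> fst d" "p \<in> fst e"
    using assms by (auto simp: charts_at_def)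
  define S where "S = snd c ` (fst c \<inter> (fst d \<inter> fst e))"
  have S: "openin (top_of_set half_space) S"
    unfolding S_def using A by (intro openin_chart_image openin_Int chart_facts)
  have x: "snd c p \<in> S" using p by (simp add: S_def)
  have "transition c d ` S \<subseteq> chart_image d" using A by (auto simp: S_def)
  hence sub: "transition c d ` S \<subseteq> half_space"
    using openin_imp_subset[OF chart_facts(2)[OF A(2)]] by blast
  have 1: "(transition c d has_derivative hderiv (transition c d) (snd c p)) (at (snd c p) within S)"
    using transition_has_hderiv[OF assms(1,2)] openin_imp_subset[OF S] by (rule has_derivative_subset)
  have 2: "(transition d e has_derivative hderiv (transition d e) (snd d p))
      (at (transition c d (snd c p)) within transition c d ` S)"
    using has_derivative_subset[OF transition_has_hderiv[OF assms(2,3)] sub] A p by simp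
  have "hderiv (transition c e) (snd c p) = hderiv (transition d e) (snd d p) \<circ> hderiv (transition c d) (snd c p)"
    by (rule hderiv_transform[OF S x diff_chain_within[OF 1 2]]) (use A in \<open>auto simp: S_def\<close>)
  thus ?thesis by simp
qed

lemma hderiv_transition_self:
  assumes "c \<in> charts_at A p"
  shows "hderiv (transition c c) (snd c p) v = v"
proof -
  have A: "c \<in> A" "p \<in> fst c" using assms by (auto simp: charts_at_def)
  have "hderiv (transition c c) (snd c p) = (\<lambda>v. v)"
    by (rule hderiv_transform[OF chart_facts(2)[OF A(1)] _ has_derivative_ident]) (use A in auto)
  thus ?thesis by simp
qed

lemma coord_vector_tangent:
  assumes "c \<in> charts_at A p"
  shows "coord_vector A c p i \<in> tangent_space A p"
  unfolding tangent_space_def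
proof (intro CollectI conjI ballI allI impI)
  fix d e assume d: "d \<in> charts_at A p" and e: "e \<in> charts_at A p"
  show "coord_vector A c p i e = hderiv (transition d e) (snd d p) (coord_vector A c p i d)"
    unfolding coord_vector_def if_P[OF d] if_P[OF e] by (rule transition_chain_rule[OF assms d e])
qed (simp add: coord_vector_def)

lemma tangent_space_lincomb:
  assumes "u \<in> tangent_space A p" "v \<in> tangent_space A p"
  shows "(\<lambda>c. a *\<^sub>R u c + b *\<^sub>R v c) \<in> tangent_space A p"
proof -
  have lin: "linear (hderiv (transition d e) (snd d p))"
    if "d \<in> charts_at A p" "e \<in> charts_at A p" for d e
    using has_derivative_linear[OF transition_has_hderiv[OF that]] .
  have u: "w e = hderiv (transition d e) (snd d p) (w d)"
    if "w \<in> tangent_space A p" "d \<in> charts_at A p" "e \<in> charts_at A p" for w d e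
    using that unfolding tangent_space_def by blast
  have z: "w d = 0" if "w \<in> tangent_space A p" "d \<notin> charts_at A p" for w d
    using that unfolding tangent_space_def by blast
  show ?thesis
    unfolding tangent_space_def
  proof (intro CollectI conjI ballI allI impI)
    fix d e assume d: "d \<in> charts_at A p" and e: "e \<in> charts_at A p"
    show "a *\<^sub>R u e + b *\<^sub>R v e = hderiv (transition d e) (snd d p) (a *\<^sub>R u d + b *\<^sub>R v d)"
      unfolding u[OF assms(1) d e] u[OF assms(2) d e]
      by (simp only: linear_add[OF lin[OF d e]] linear_cmul[OF lin[OF d e]])
  qed (simp add: z[OF assms(1)] z[OF assms(2)])
qed

text \<open>
  The vector \<open>u\<close> is the coordinate vector in the chart \<open>c\<close> of the tangent vector \<open>\<Sum>\<^sub>i u\<^sub>i \<partial>\<^sub>i\<close>; hence positivity of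
  the metric on tangent vectors passes to its matrix.
\<close>

lemma gram_symmetric_positive:
  assumes g: "riemannian_metric M A g" and c: "c \<in> A" and y: "y \<in> chart_image c"
  shows "transpose (gram A g c y) = gram A g c y"
    and "u \<noteq> 0 \<Longrightarrow> u \<bullet> (gram A g c y *v u) > 0"
proof -
  obtain p where p: "p \<in> fst c" "y = snd c p" using y by blast
  have pM: "p \<in> topspace M" using openin_subset[OF chart_facts(1)[OF c]] p by blast
  have cp: "c \<in> charts_at A p" using c p by (simp add: charts_at_def)
  note tan = coord_vector_tangent[OF cp]
  let ?e = "coord_vector A c p"
  have lin: "g p (\<lambda>c. a *\<^sub>R u c + b *\<^sub>R v c) w = a * g p u w + b * g p v w"
    and sym: "g p u v = g p v u" and pos: "u \<noteq> (\<lambda>c. 0) \<Longrightarrow> g p u u > 0"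
    if "u \<in> tangent_space A p" "v \<in> tangent_space A p" "w \<in> tangent_space A p" for u v w a b
  proof -
    note bspec[OF bspec[OF bspec[OF conjunct1[OF g[unfolded riemannian_metric_def]] pM] that(1)] that(2)]
    thus "g p (\<lambda>c. a *\<^sub>R u c + b *\<^sub>R v c) w = a * g p u w + b * g p v w"
      "g p u v = g p v u" "u \<noteq> (\<lambda>c. 0) \<Longrightarrow> g p u u > 0"
      using that(3) by auto
  qed
  have gr: "gram A g c y $ i $ j = g p (?e i) (?e j)" for i j
    using c p by (simp add: gram_def)
  show "transpose (gram A g c y) = gram A g c y"
    by (simp add: vec_eq_iff gr sym[OF tan tan tan])
  show "u \<bullet> (gram A g c y *v u) > 0" if u: "u \<noteq> 0"
  proof -
    define r where "r = (\<lambda>d. u $ 2 *\<^sub>R ?e 2 d + u $ 3 *\<^sub>R ?e 3 d)"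
    define v where "v = (\<lambda>d. u $ 1 *\<^sub>R ?e 1 d + 1 *\<^sub>R r d)"
    have r: "r \<in> tangent_space A p" unfolding r_def by (intro tangent_space_lincomb tan)
    have v: "v \<in> tangent_space A p" unfolding v_def by (intro tangent_space_lincomb tan r)
    have gv: "g p v w = u $ 1 * g p (?e 1) w + u $ 2 * g p (?e 2) w + u $ 3 * g p (?e 3) w"
      if "w \<in> tangent_space A p" for w
    proof -
      have "g p v w = u $ 1 * g p (?e 1) w + 1 * g p r w"
        unfolding v_def by (rule lin[OF tan r that])
      moreover have "g p r w = u $ 2 * g p (?e 2) w + u $ 3 * g p (?e 3) w"
        unfolding r_def by (rule lin[OF tan tan that])
      ultimately show ?thesis by simp
    qed
    have gv': "g p (?e i) v = u $ 1 * g p (?e i) (?e 1) + u $ 2 * g p (?e i) (?e 2) + u $ 3 * g p (?e i) (?e 3)" for i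
      unfolding sym[OF tan v v] gv[OF tan] by (simp add: sym[OF tan tan tan, of _ i])
    have "v c = u"
      using cp unfolding v_def r_def coord_vector_def
      by (simp add: hderiv_transition_self[OF cp] vec_eq_iff forall_3 axis_def)
    hence "v \<noteq> (\<lambda>c. 0)" using u by auto
    hence "g p v v > 0" by (rule pos[OF v v v])
    also have "g p v v = u \<bullet> (gram A g c y *v u)"
      unfolding gv[OF v] gv' by (simp add: inner_vec_def sum_3 matrix_vector_nth3 gr algebra_simps)
    finally show ?thesis .
  qed
qed

lemma local_rep_eq_zero:
  assumes "\<forall>p\<in>topspace M. X p = (\<lambda>c. 0)" "c \<in> A" "y \<in> chart_image c"
  shows "vcomp X c y = 0"
  using assms openin_subset[OF chart_facts(1)[OF assms(2)]] by auto

lemma zero_field_curl_killing: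
  assumes "zero_field_on M X"
  shows "killing_field A g X" "has_curl A g X (scale_field lam X)"
proof -
  have z: "flat (gram A g c) (vcomp X c) y $ j = 0" if "c \<in> A" "y \<in> chart_image c" for c y j
    using local_rep_eq_zero[OF assms[unfolded zero_field_on_def] that] by (simp add: flat_def)
  have d: "pd i (\<lambda>y. flat (gram A g c) (vcomp X c) y $ j) x = 0"
    if "c \<in> A" "x \<in> chart_image c" for c x i j
  proof -
    have "hderiv (\<lambda>y. flat (gram A g c) (vcomp X c) y $ j) x = (\<lambda>_. 0)"
      by (rule hderiv_transform[OF chart_facts(2)[OF that(1)] that(2) has_derivative_const[of 0]])
         (rule z[OF that(1)])
    thus ?thesis by simp
  qed
  show "killing_field A g X"
    by (simp add: killing_field_def covariant_deriv1_def z d)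
  have "flat (gram A g c) (vcomp (scale_field lam X) c) x = 0"
    if "c \<in> A" "x \<in> chart_image c" for c x
    using local_rep_eq_zero[OF assms[unfolded zero_field_on_def] that]
    by (simp add: flat_def local_rep_def scale_field_def vec_eq_iff)
  moreover have "hodge2 (gram A g c) (ext_deriv1 (flat (gram A g c) (vcomp X c))) x = 0"
    if "c \<in> A" "x \<in> chart_image c" for c x
    by (simp add: hodge2_def ext_deriv1_def d[OF that] vec_eq_iff)
  ultimately show "has_curl A g X (scale_field lam X)" by (simp add: has_curl_def)
qed

lemma nonzero_interior_point:
  assumes Y: "smooth_vector_field M A Y" "\<not> zero_field_on M Y"
  obtains c N x where "c \<in> A" "open N" "N \<subseteq> half_space" "N \<subseteq> chart_image c" "x \<in> N" "vcomp Y c x \<noteq> 0"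
proof -
  obtain p d where p: "p \<in> topspace M" and d: "Y p d \<noteq> 0"
    using Y(2) unfolding zero_field_on_def by blast
  have "Y p \<in> tangent_space A p" using Y(1) p by (simp add: smooth_vector_field_def)
  hence "d \<in> charts_at A p" using d unfolding tangent_space_def by blast
  hence dA: "d \<in> A" and pd: "p \<in> fst d" by (auto simp: charts_at_def)
  define x0 where "x0 = snd d p"
  have x0: "x0 \<in> chart_image d" "vcomp Y d x0 \<noteq> 0"
    using pd dA d by (auto simp: x0_def)
  obtain T where T: "open T" "chart_image d = half_space \<inter> T"
    using chart_facts(2)[OF dA] by (auto simp: openin_open)
  have "smooth_on (chart_image d) (vcomp Y d)" using Y(1) dA by (simp add: smooth_vector_field_def)
  from bspec[OF this[unfolded smooth_on_def] x0(1)]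
  obtain U F where UF: "open U \<and> x0 \<in> U \<and> (\<forall>k. Ck_open k U F) \<and>
      (\<forall>y\<in>chart_image d \<inter> U. F y = vcomp Y d y)"
    by (elim exE) (rule that)
  hence U: "open U" "x0 \<in> U" "Ck_open 0 U F" "y \<in> chart_image d \<inter> U \<Longrightarrow> F y = vcomp Y d y" for y
    by blast+
  define W where "W = (U \<inter> F -` (- {0})) \<inter> T"
  have "open (U \<inter> F -` (- {0}))"
    using U by (intro continuous_open_preimage) auto
  hence W: "open W" unfolding W_def using T(1) by (rule open_Int)
  have "x0 \<in> W" using U x0 T by (auto simp: W_def)
  then obtain r where r: "r > 0" "ball x0 r \<subseteq> W" using W by (meson open_contains_ball)
  define x where "x = x0 + (r / 2) *\<^sub>R axis 3 1"
  have "dist x0 x < r" using r by (simp add: x_def dist_norm norm_axis_1)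
  hence xW: "x \<in> W" using r by auto
  have "x0 $ 3 \<ge> 0" using x0(1) T by (auto simp: half_space_def)
  hence x3: "x $ 3 > 0" using r by (simp add: x_def axis_def)
  define N where "N = T \<inter> {x. x $ 3 > 0}"
  show ?thesis
  proof (rule that[of d N x])
    show "open N" unfolding N_def using T(1)
      by (intro open_Int open_Collect_less continuous_intros)
    show "N \<subseteq> half_space" by (auto simp: N_def half_space_def)
    thus NS: "N \<subseteq> chart_image d" unfolding T by (auto simp: N_def)
    show xN: "x \<in> N" using xW x3 by (simp add: N_def W_def)
    show "vcomp Y d x \<noteq> 0" using U(4)[of x] NS xN xW by (auto simp: W_def)
  qed (rule dA)
qed

lemma curl_eigenfield_constant_curvature:
  assumes g: "riemannian_metric M A g" "constant_sectional_curvature A g c"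
    and Y: "smooth_vector_field M A Y" "\<not> zero_field_on M Y" "killing_field A g Y"
      "has_curl A g Y (scale_field lam Y)"
  shows "c = lam\<^sup>2 / 4"
proof -
  obtain d N x where d: "d \<in> A" and N: "open N" "N \<subseteq> half_space" "N \<subseteq> chart_image d" "x \<in> N"
    and Yx: "vcomp Y d x \<noteq> 0"
    using nonzero_interior_point[OF Y(1,2)] by blast
  have sc: "vcomp (scale_field lam Y) d = (\<lambda>y. lam *\<^sub>R vcomp Y d y)"
    by (simp add: fun_eq_iff local_rep_def scale_field_def)
  have NS: "y \<in> chart_image d" if "y \<in> N" for y using N(3) that by blast
  show ?thesis
  proof (rule curl_eigenfield_curvature[OF N(1,2,4), of "gram A g d" "vcomp Y d"])
    show "transpose (gram A g d y) = gram A g d y" if "y \<in> N" for y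
      by (rule gram_symmetric_positive(1)[OF g(1) d NS[OF that]])
    show "u \<bullet> (gram A g d y *v u) > 0" if "y \<in> N" "u \<noteq> 0" for y u
      by (rule gram_symmetric_positive(2)[OF g(1) d NS[OF that(1)] that(2)])
    show "Ck_open (Suc (Suc 0)) N (gram A g d)"
      using g(1) d N by (intro smooth_on_imp_Ck_open[of "chart_image d"]) (auto simp: riemannian_metric_def)
    show "Ck_open (Suc (Suc 0)) N (vcomp Y d)"
      using Y(1) d N by (intro smooth_on_imp_Ck_open[of "chart_image d"]) (auto simp: smooth_vector_field_def)
    show "covariant_deriv1 (gram A g d) (flat (gram A g d) (vcomp Y d)) i j y
        + covariant_deriv1 (gram A g d) (flat (gram A g d) (vcomp Y d)) j i y = 0" if "y \<in> N" for y i j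
      using Y(3) d NS[OF that] unfolding killing_field_def by blast
    show "flat (gram A g d) (\<lambda>y. lam *\<^sub>R vcomp Y d y) y
        = hodge2 (gram A g d) (ext_deriv1 (flat (gram A g d) (vcomp Y d))) y" if "y \<in> N" for y
      using Y(4) d NS[OF that] unfolding has_curl_def sc[symmetric] by blast
    show "sectional_curvature (gram A g d) x u v = c" if "u \<noteq> v" "independent {u, v}" for u v
      using g(2) d NS[OF N(4)] that unfolding constant_sectional_curvature_def by blast
  qed (rule Yx)
qed

end

theorem theoremA1:
  fixes M :: "'m topology" and A :: "'m chart set" and g :: "'m metric" and c :: real
  assumes "oriented_smooth_manifold3 M A"
    and "connected_space M"
    and "riemannian_metric M A g"
    and "constant_sectional_curvature A g c"
  shows "(\<forall>Y lam. smooth_vector_field M A Y \<and> \<not> zero_field_on M Y \<and> killing_field A g Y \<and>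
             has_curl A g Y (scale_field lam Y) \<longrightarrow> c = lam\<^sup>2 / 4) \<and>
         (c < 0 \<longrightarrow>
           (\<forall>Y. smooth_vector_field M A Y \<longrightarrow>
             ((killing_field A g Y \<and> (\<exists>lam. has_curl A g Y (scale_field lam Y))) \<longleftrightarrow>
              zero_field_on M Y)))"
proof (intro conjI allI impI iffI)
  show main: "c = lam\<^sup>2 / 4"
    if "smooth_vector_field M A Y \<and> \<not> zero_field_on M Y \<and> killing_field A g Y \<and>
        has_curl A g Y (scale_field lam Y)" for Y lam
    using curl_eigenfield_constant_curvature[OF assms(1,3,4)] that by blast
  fix Y assume c: "c < 0" and Y: "smooth_vector_field M A Y"
  show "zero_field_on M Y"
    if kc: "killing_field A g Y \<and> (\<exists>lam. has_curl A g Y (scale_field lam Y))"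
  proof (rule ccontr)
    assume "\<not> zero_field_on M Y"
    then obtain lam where "c = lam\<^sup>2 / 4" using kc Y main by blast
    thus False using c zero_le_power2[of lam] by linarith
  qed
  assume "zero_field_on M Y"
  note zero = zero_field_curl_killing[OF assms(1) this]
  show "killing_field A g Y" by (rule zero(1))
  show "\<exists>lam. has_curl A g Y (scale_field lam Y)" by (rule exI, rule zero(2)[of _ 0])
qed

end
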